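(* Let $\alpha\in(0,1)$. There is no universal constant $C=C(\alpha,d)>0$ such that $$\int_{\mathbb{R}^d}|u|\,d\mu\le C\int_{\mathbb{R}^d}|D^\alpha u|$$ for all $u\in L^q(\mathbb{R}^d)\cap C(\mathbb{R}^d)$ for some $1\le q<d/(1-\alpha)$ such that $D^\alpha u\in L^1(\mathbb{R}^d;\mathbb{R}^d)$ and all non-negative Radon measures $\mu$ such that $\mu(B(x,r))\le C' r^{d-\alpha}$ for all $x\in\mathbb{R}^d$ and $r>0$, for some constant $C'>0$.
   Context: Here $d$ is the dimension of the Euclidean space $\mathbb{R}^d$. For $s\in(0,d)$ the Riesz potential of order $s$ is $$I_s f(x)=\frac{1}{\gamma(s)}\int_{\mathbb{R}^d}\frac{f(y)}{|x-y|^{d-s}}\,dy,\qquad \gamma(s)=\frac{\pi^{d/2}2^s\Gamma(s/2)}{\Gamma(d/2-s/2)}.$$ For $u\in L^q(\mathbb{R}^d)$ with some $1\le q<d/(1-\alpha)$ one has $I_{1-\alpha}u\in L^1_{loc}(\mathbb{R}^d)$, and the fractional gradient $D^\alpha u:=\nabla I_{1-\alpha}u$ is defined distributionally by $$\langle D^\alpha u,\Phi\rangle:=-\int_{\mathbb{R}^d}I_{1-\alpha}u(x)\,\operatorname{div}\Phi(x)\,dx\qquad\text{for }\Phi\in C_c^\infty(\mathbb{R}^d;\mathbb{R}^d).$$ The condition $D^\alpha u\in L^1(\mathbb{R}^d;\mathbb{R}^d)$ means that this distribution is represented by an integrable vector field, also denoted $D^\alpha u$; the integral of $|D^\alpha u|$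 is with respect to Lebesgue measure. $C(\mathbb{R}^d)$ denotes the continuous functions on $\mathbb{R}^d$, and $B(x,r)$ is the ball of center $x$ and radius $r$. *)

theory Defs
  imports "HOL-Analysis.Analysis"
begin

definition riesz_const :: "nat \<Rightarrow> real \<Rightarrow> real" where
  "riesz_const d s =
     pi powr (real d / 2) * 2 powr s * Gamma (s / 2) / Gamma (real d / 2 - s / 2)"

text \<open>
  The Bochner integral is \<open>0\<close> wherever the integrand fails to be integrable. For the functions to which
  the potential is applied below, this happens on a Lebesgue null set only.
\<close>

definition riesz_potential :: "real \<Rightarrow> ('a::euclidean_space \<Rightarrow> real) \<Rightarrow> 'a \<Rightarrow> real" where
  "riesz_potential s f x =
     1 / riesz_const DIM('a) s *
       (LINT y|lborel. f y / norm (x - y) powr (real DIM('a) - s))"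

definition in_Lp :: "real \<Rightarrow> ('a::euclidean_space \<Rightarrow> real) \<Rightarrow> bool" where
  "in_Lp q f \<longleftrightarrow>
     f \<in> borel_measurable lborel \<and> integrable lborel (\<lambda>x. \<bar>f x\<bar> powr q)"

primrec Ck :: "nat \<Rightarrow> ('a::euclidean_space \<Rightarrow> 'b::real_normed_vector) \<Rightarrow> bool" where
  "Ck 0 f \<longleftrightarrow> continuous_on UNIV f"
| "Ck (Suc k) f \<longleftrightarrow>
     (\<forall>x. f differentiable (at x)) \<and> (\<forall>v. Ck k (\<lambda>x. frechet_derivative f (at x) v))"

definition test_field :: "('a::euclidean_space \<Rightarrow> 'a) \<Rightarrow> bool" where
  "test_field \<Phi> \<longleftrightarrow> (\<forall>k. Ck k \<Phi>) \<and> compact (closure {x. \<Phi> x \<noteq> 0})"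

definition divergence :: "('a::euclidean_space \<Rightarrow> 'a) \<Rightarrow> 'a \<Rightarrow> real" where
  "divergence \<Phi> x = (\<Sum>b\<in>Basis. frechet_derivative \<Phi> (at x) b \<bullet> b)"

definition frac_gradient :: "real \<Rightarrow> ('a::euclidean_space \<Rightarrow> real) \<Rightarrow> ('a \<Rightarrow> 'a) \<Rightarrow> real" where
  "frac_gradient \<alpha> u \<Phi> =
     - (LINT x|lborel. riesz_potential (1 - \<alpha>) u x * divergence \<Phi> x)"

text \<open>
  The distribution \<open>frac_gradient \<alpha> u\<close> belongs to \<open>L\<^sup>1\<close> and is represented by the field \<open>g\<close>, which is
  then determined up to a Lebesgue null set.
\<close>

definition frac_gradient_L1 ::
    "real \<Rightarrow> ('a::euclidean_space \<Rightarrow> real) \<Rightarrow> ('a \<Rightarrow> 'a) \<Rightarrow> bool" where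
  "frac_gradient_L1 \<alpha> u g \<longleftrightarrow>
     integrable lborel g \<and>
     (\<forall>\<Phi>. test_field \<Phi> \<longrightarrow> frac_gradient \<alpha> u \<Phi> = (LINT x|lborel. g x \<bullet> \<Phi> x))"

definition radon_measure :: "'a::euclidean_space measure \<Rightarrow> bool" where
  "radon_measure \<mu> \<longleftrightarrow>
     sets \<mu> = sets borel \<and>
     (\<forall>K. compact K \<longrightarrow> emeasure \<mu> K < \<infinity>) \<and>
     (\<forall>A\<in>sets borel. emeasure \<mu> A = (INF U\<in>{U. open U \<and> A \<subseteq> U}. emeasure \<mu> U)) \<and>
     (\<forall>U. open U \<longrightarrow> emeasure \<mu> U = (SUP K\<in>{K. compact K \<and> K \<subseteq> U}. emeasure \<mu> K))"

definition ball_growth :: "real \<Rightarrow> real \<Rightarrow> 'a::euclidean_space measure \<Rightarrow> bool" where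
  "ball_growth c s \<mu> \<longleftrightarrow>
     (\<forall>x r. 0 < r \<longrightarrow> emeasure \<mu> (ball x r) \<le> ennreal (c * r powr s))"

end

theory Submission
  imports Defs "HOL-Probability.Distributions"
begin

text \<open>
  The claim rests on the fact that a function whose fractional gradient is a finite measure can blow
  up like \<open>dist\<^sup>-\<^sup>1\<^sup>+\<^sup>\<alpha>\<close> along a whole hypersurface. Put \<open>\<beta> = (1 - \<alpha>) / 2\<close>, so that \<open>I\<^bsub>1-\<alpha>\<^esub>\<close> inverts the
  operator \<open>(-\<Delta>)\<^sup>\<beta>\<close>, and let \<open>E\<close> be the unit cube. The function \<open>u = (-\<Delta>)\<^sup>\<beta> \<chi>\<^sub>E\<close> satisfies
  \<open>I\<^bsub>1-\<alpha>\<^esub> u = \<chi>\<^sub>E\<close>, so \<open>D\<^sup>\<alpha> u\<close> is the gradient of \<open>\<chi>\<^sub>E\<close>, a measure of finite mass; and outside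
  the cube, at distance \<open>\<delta>\<close> from a face, \<open>|u|\<close> is comparable to \<open>\<delta>\<close> to the power \<open>-2 \<beta> = \<alpha> - 1\<close>. The
  measure \<open>\<mu>\<close> with density \<open>\<delta>\<^sup>-\<^sup>\<alpha>\<close> in a unit layer next to one face has growth \<open>r\<^bsup>d-\<alpha>\<^esup>\<close>,
  because a ball of radius \<open>r\<close> meets the layer in a set of width at most \<open>2 r\<close> and
  \<open>\<delta>\<^sup>-\<^sup>\<alpha>\<close> integrates to order \<open>r\<^bsup>1-\<alpha>\<^esup>\<close> over such a width. The integral of \<open>|u|\<close> against
  \<open>\<mu>\<close> is then of the order of the integral of \<open>1 / \<delta>\<close> over \<open>(0, 1)\<close>, which diverges.

  Since \<open>u\<close> must be continuous and \<open>D\<^sup>\<alpha> u\<close> integrable, \<open>\<chi>\<^sub>E\<close> is replaced by its heat flow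
  \<open>cube_flow \<tau>\<close>, averaged over \<open>\<epsilon> < \<tau> \<le> 2 \<epsilon>\<close>. All operators are expressed through the heat
  semigroup. The Riesz kernel is a superposition of heat kernels with weight \<open>r\<^bsup>\<beta>-1\<^esup>\<close>
  (\<open>riesz_kernel_subordination\<close>), so the semigroup law turns the Riesz potential of a superposition of
  the \<open>cube_flow s\<close> with weight \<open>a\<close> into the superposition whose weight is the Riemann-Liouville
  fractional integral of \<open>a\<close> (\<open>riesz_potential_superposition\<close>). For the Abel weight, which is
  the fractional derivative of the normalised indicator of \<open>(\<epsilon>, 2 \<epsilon>]\<close>, a Beta integral gives back that
  indicator (\<open>abel_weight_convolution\<close>), and the potential is the averaged heat flow.

  The gradient of \<open>cube_flow \<tau>\<close> is explicit and its \<open>L\<^sup>1\<close> norm is bounded independently of \<open>\<tau>\<close>,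
  whence a bound on \<open>D\<^sup>\<alpha> u\<close> that does not depend on \<open>\<epsilon>\<close>
  (\<open>mollified_frac_laplacian_frac_gradient\<close>). For \<open>s > 2 \<epsilon>\<close> the Abel weight is negative and at least of
  the size of \<open>s\<^bsup>-\<beta>-1\<^esup>\<close>, and the flow at distance \<open>\<delta>\<close> from the face is bounded below for \<open>s\<close> near
  \<open>\<delta>\<^sup>2\<close>; this yields the blow-up in the limit \<open>\<epsilon> \<rightarrow> 0\<close> (\<open>mollified_frac_laplacian_blowup\<close>).
  Fatou's lemma for one fixed measure \<open>\<mu>\<close> then refutes every constant.
\<close>

section \<open>The one-dimensional heat flow of an interval\<close>

text \<open>
  The value \<open>0\<close> for \<open>s \<le> 0\<close> keeps the kernel nonnegative for all real times.
\<close>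

definition heat :: "real \<Rightarrow> real \<Rightarrow> real" where
  "heat s t = (if 0 < s then exp (- t\<^sup>2 / (4 * s)) / sqrt (4 * pi * s) else 0)"

lemma heat_measurable [measurable (raw)]:
  assumes [measurable]: "f \<in> borel_measurable M" "g \<in> borel_measurable M"
  shows "(\<lambda>x. heat (f x) (g x)) \<in> borel_measurable M"
  unfolding heat_def by measurable

lemma heat_nonneg [simp]: "0 \<le> heat s t"
  by (simp add: heat_def)

lemma heat_minus_commute: "heat s (t - y) = heat s (y - t)"
  by (simp add: heat_def power2_commute)

lemma heat_eq_normal_density: "0 < s \<Longrightarrow> heat s t = normal_density 0 (sqrt (2 * s)) t"
  by (simp add: heat_def normal_density_def mult_ac)

lemma heat_le:
  assumes "0 < s" shows "heat s t \<le> 1 / sqrt s"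
proof -
  have "1 * s \<le> 4 * pi * s"
    using pi_ge_two assms by (intro mult_right_mono) auto
  then have "sqrt s \<le> sqrt (4 * pi * s)" by simp
  moreover have "exp (- t\<^sup>2 / (4 * s)) \<le> 1" using assms by simp
  ultimately show ?thesis using assms
    by (simp add: heat_def frac_le)
qed

lemma heat_antimono:
  assumes "\<bar>t\<bar> \<le> \<bar>t'\<bar>" shows "heat s t' \<le> heat s t"
proof (cases "0 < s")
  case True
  have "t\<^sup>2 \<le> t'\<^sup>2" using assms by (simp add: abs_le_square_iff)
  then show ?thesis using True by (simp add: heat_def divide_simps)
qed (simp add: heat_def)

lemma continuous_heat: "continuous_on A (heat s)"
  by (cases "0 < s") (auto simp: heat_def[abs_def] intro!: continuous_intros)

lemma nn_integral_heat:
  assumes "0 < s" shows "(\<integral>\<^sup>+ t. ennreal (heat s t) \<partial>lborel) = 1"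
proof -
  have "(\<integral>\<^sup>+ t. ennreal (normal_density 0 (sqrt (2 * s)) t) \<partial>lborel)
      = ennreal (LINT t|lborel. normal_density 0 (sqrt (2 * s)) t)"
    using assms by (intro nn_integral_eq_integral) auto
  then show ?thesis using assms by (simp add: heat_eq_normal_density)
qed

lemma nn_integral_heat_translate:
  assumes "0 < s" shows "(\<integral>\<^sup>+ t. ennreal (heat s (t - c)) \<partial>lborel) = 1"
  using nn_integral_real_affine[of "\<lambda>t. ennreal (heat s (t - c))" 1 c] nn_integral_heat[OF assms]
  by simp

lemma heat_convolution:
  assumes "0 < s" "0 < r"
  shows "(\<integral>\<^sup>+ y. ennreal (heat s (y - c) * heat r (t - y)) \<partial>lborel) = ennreal (heat (s + r) (t - c))"
proof -
  have "(\<integral>\<^sup>+ y. ennreal (heat s (y - c) * heat r (t - y)) \<partial>lborel)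
      = (\<integral>\<^sup>+ y. ennreal (heat s y * heat r ((t - c) - y)) \<partial>lborel)"
    by (subst nn_integral_real_affine[where c = 1 and t = c]) (auto simp: algebra_simps)
  also have "\<dots> = (\<integral>\<^sup>+ y. ennreal (normal_density 0 (sqrt (2 * r)) ((t - c) - y)
      * normal_density 0 (sqrt (2 * s)) y) \<partial>lborel)"
    using assms by (simp add: heat_eq_normal_density mult.commute)
  also have "\<dots> = normal_density 0 (sqrt ((sqrt (2 * r))\<^sup>2 + (sqrt (2 * s))\<^sup>2)) (t - c)"
    using assms by (subst conv_normal_density_zero_mean[THEN fun_cong, symmetric]) auto
  also have "\<dots> = heat (s + r) (t - c)"
    using assms by (simp add: heat_eq_normal_density algebra_simps)
  finally show ?thesis .
qed

text \<open>
  The solution of the heat equation at time \<open>s\<close> whose initial value is the indicator of \<open>[0, 1]\<close>.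
\<close>

definition slab :: "real \<Rightarrow> real \<Rightarrow> real" where
  "slab s t = (LINT y|lborel. indicator {0..1} y * heat s (t - y))"

lemma slab_measurable [measurable (raw)]:
  assumes [measurable]: "f \<in> borel_measurable M" "g \<in> borel_measurable M"
  shows "(\<lambda>x. slab (f x) (g x)) \<in> borel_measurable M"
  unfolding slab_def by measurable

lemma slab_nonneg [simp]: "0 \<le> slab s t"
  unfolding slab_def by (intro Bochner_Integration.integral_nonneg) auto

lemma ennreal_slab: "ennreal (slab s t) = (\<integral>\<^sup>+ y. ennreal (indicator {0..1} y * heat s (t - y)) \<partial>lborel)"
proof -
  have "integrable lborel (\<lambda>y. indicator {0..1} y *\<^sub>R heat s (t - y))"
    by (intro borel_integrable_compact continuous_on_compose2[OF continuous_heat[of UNIV]] continuous_intros) auto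
  then show ?thesis unfolding slab_def by (subst nn_integral_eq_integral) auto
qed

lemma ennreal_slab_le:
  assumes "0 < s" shows "ennreal (slab s t) \<le> 1"
proof -
  have "ennreal (slab s t) \<le> (\<integral>\<^sup>+ y. ennreal (heat s (y - t)) \<partial>lborel)"
    unfolding ennreal_slab by (intro nn_integral_mono) (auto simp: indicator_def heat_minus_commute[of s t])
  then show ?thesis using assms by (simp add: nn_integral_heat_translate)
qed

lemma slab_le_1: "0 < s \<Longrightarrow> slab s t \<le> 1"
  using ennreal_slab_le[of s t] by simp

lemma slab_le:
  assumes "0 \<le> M" "\<And>y. 0 \<le> y \<Longrightarrow> y \<le> 1 \<Longrightarrow> heat s (t - y) \<le> M"
  shows "slab s t \<le> M"
proof -
  have "ennreal (slab s t) \<le> (\<integral>\<^sup>+ y. ennreal M * indicator {0..1::real} y \<partial>lborel)"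
    unfolding ennreal_slab by (intro nn_integral_mono) (use assms in \<open>auto simp: indicator_def\<close>)
  then show ?thesis using assms(1) by (simp add: nn_integral_cmult)
qed

lemma slab_ge:
  assumes "0 \<le> M" "0 \<le> l" "{c..c + l} \<subseteq> {0..1}" "\<And>y. c \<le> y \<Longrightarrow> y \<le> c + l \<Longrightarrow> M \<le> heat s (t - y)"
  shows "l * M \<le> slab s t"
proof -
  have "ennreal (l * M) = (\<integral>\<^sup>+ y. ennreal M * indicator {c..c + l} y \<partial>lborel)"
    using assms(1,2) by (simp add: nn_integral_cmult ennreal_mult' mult.commute)
  also have "\<dots> \<le> ennreal (slab s t)"
    unfolding ennreal_slab by (intro nn_integral_mono) (use assms in \<open>auto simp: indicator_def\<close>)
  finally show ?thesis by simp
qed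

lemma slab_pos:
  assumes "0 < s" shows "0 < slab s t"
proof -
  define z where "z = \<bar>t\<bar> + 1"
  have "1 * heat s z \<le> slab s t"
    by (rule slab_ge[where c = 0]) (auto simp: z_def intro!: heat_antimono)
  moreover have "0 < heat s z" using assms by (simp add: heat_def)
  ultimately show ?thesis by simp
qed

text \<open>
  The semigroup law, inherited from the Gaussian convolution formula by exchanging the two integrals.
\<close>

lemma slab_convolution:
  assumes "0 < s" "0 < r"
  shows "(\<integral>\<^sup>+ y. ennreal (slab s y * heat r (t - y)) \<partial>lborel) = ennreal (slab (s + r) t)"
proof -
  have "(\<integral>\<^sup>+ y. ennreal (slab s y * heat r (t - y)) \<partial>lborel) =
    (\<integral>\<^sup>+ y. (\<integral>\<^sup>+ z. ennreal (indicator {0..1} z) * ennreal (heat s (y - z) * heat r (t - y)) \<partial>lborel) \<partial>lborel)"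
    by (simp add: ennreal_mult' ennreal_slab nn_integral_multc [symmetric] ennreal_mult'' mult.assoc)
  also have "\<dots> = (\<integral>\<^sup>+ z. (\<integral>\<^sup>+ y. ennreal (indicator {0..1} z) * ennreal (heat s (y - z) * heat r (t - y)) \<partial>lborel) \<partial>lborel)"
    by (rule lborel_pair.Fubini') measurable
  also have "\<dots> = (\<integral>\<^sup>+ z. ennreal (indicator {0..1} z * heat (s + r) (t - z)) \<partial>lborel)"
    using assms by (simp add: nn_integral_cmult heat_convolution ennreal_mult'[OF indicator_pos_le]
      del: ennreal_mult' ennreal_mult'')
  finally show ?thesis by (simp add: ennreal_slab)
qed

lemma nn_integral_slab:
  assumes "0 < s" shows "(\<integral>\<^sup>+ t. ennreal (slab s t) \<partial>lborel) = 1"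
proof -
  have "(\<integral>\<^sup>+ t. ennreal (slab s t) \<partial>lborel) =
    (\<integral>\<^sup>+ z. (\<integral>\<^sup>+ t. ennreal (indicator {0..1} z) * ennreal (heat s (t - z)) \<partial>lborel) \<partial>lborel)"
    unfolding ennreal_slab ennreal_mult'[OF indicator_pos_le] by (rule lborel_pair.Fubini') measurable
  also have "\<dots> = (\<integral>\<^sup>+ z. indicator {0..1::real} z \<partial>lborel)"
    using assms by (simp add: nn_integral_cmult nn_integral_heat_translate ennreal_indicator)
  finally show ?thesis by simp
qed

text \<open>
  After the substitution \<open>z = t - y\<close>, \<open>slab s t\<close> is the integral of \<open>heat s\<close> over the moving interval
  \<open>[t - 1, t]\<close>; the two boundary terms are the derivative.
\<close>

lemma slab_has_derivative:
  "(slab s has_real_derivative heat s t - heat s (t - 1)) (at t)"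
proof -
  obtain F where F: "\<And>x. (F has_vector_derivative heat s x) (at x)"
  proof -
    have "isCont (heat s) x" for x
      using continuous_heat[of UNIV s] by (simp add: continuous_on_eq_continuous_at)
    then have "\<exists>F. \<forall>x. -\<infinity> < ereal x \<longrightarrow> ereal x < \<infinity> \<longrightarrow> (F has_vector_derivative heat s x) (at x)"
      by (intro einterval_antiderivative) auto
    then show thesis using that by auto
  qed
  have "slab s x = F x - F (x - 1)" for x
  proof -
    have "slab s x = (LINT z|lborel. indicator {0..1} (x - z) * heat s z)"
      unfolding slab_def
      by (subst lborel_integral_real_affine[where c = "-1" and t = x]) simp_all
    also have "\<dots> = (LINT z|lborel. indicator {x - 1..x} z *\<^sub>R heat s z)"
      by (rule Bochner_Integration.integral_cong) (auto split: split_indicator)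
    also have "\<dots> = F x - F (x - 1)"
    proof (rule integral_FTC_atLeastAtMost)
      show "(F has_vector_derivative heat s z) (at z within {x - 1..x})" for z
        by (rule has_vector_derivative_at_within[OF F])
    qed (simp_all add: continuous_heat)
    finally show ?thesis .
  qed
  then have eq: "slab s = (\<lambda>x. F x - F (x - 1))" by auto
  have D: "(F has_real_derivative heat s x) (at x)" for x
    using F by (simp add: has_real_derivative_iff_has_vector_derivative)
  show ?thesis unfolding eq
    using DERIV_diff[OF D[of t] DERIV_shift[THEN iffD1, OF D[of "t + -1"]]] by simp
qed

section \<open>The heat flow of the unit cube\<close>

definition heat_kernel :: "real \<Rightarrow> 'a::euclidean_space \<Rightarrow> real" where
  "heat_kernel s x = (\<Prod>b\<in>Basis. heat s (x \<bullet> b))"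

text \<open>
  The heat flow of the indicator of the unit cube: heat kernel and initial value are both products
  over the coordinates.
\<close>

definition cube_flow :: "real \<Rightarrow> 'a::euclidean_space \<Rightarrow> real" where
  "cube_flow s x = (\<Prod>b\<in>Basis. slab s (x \<bullet> b))"

text \<open>
  The derivative of \<open>cube_flow s\<close> in the direction \<open>b\<close>. As \<open>s\<close> tends to \<open>0\<close> it concentrates on the two
  faces of the cube that are orthogonal to \<open>b\<close>.
\<close>

definition cube_flow_partial :: "'a \<Rightarrow> real \<Rightarrow> 'a::euclidean_space \<Rightarrow> real" where
  "cube_flow_partial b s x =
     (heat s (x \<bullet> b) - heat s (x \<bullet> b - 1)) * (\<Prod>b'\<in>Basis - {b}. slab s (x \<bullet> b'))"

lemma heat_kernel_measurable [measurable (raw)]: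
  fixes g :: "'m \<Rightarrow> 'a::euclidean_space"
  assumes [measurable]: "f \<in> borel_measurable M" "g \<in> borel_measurable M"
  shows "(\<lambda>x. heat_kernel (f x) (g x)) \<in> borel_measurable M"
  unfolding heat_kernel_def by measurable

lemma cube_flow_measurable [measurable (raw)]:
  fixes g :: "'m \<Rightarrow> 'a::euclidean_space"
  assumes [measurable]: "f \<in> borel_measurable M" "g \<in> borel_measurable M"
  shows "(\<lambda>x. cube_flow (f x) (g x)) \<in> borel_measurable M"
  unfolding cube_flow_def by measurable

lemma cube_flow_partial_measurable [measurable (raw)]:
  fixes g :: "'m \<Rightarrow> 'a::euclidean_space"
  assumes [measurable]: "f \<in> borel_measurable M" "g \<in> borel_measurable M"
  shows "(\<lambda>x. cube_flow_partial b (f x) (g x)) \<in> borel_measurable M"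
  unfolding cube_flow_partial_def by measurable

lemma heat_kernel_nonneg [simp]: "0 \<le> heat_kernel s x"
  by (simp add: heat_kernel_def prod_nonneg)

lemma cube_flow_nonneg [simp]: "0 \<le> cube_flow s x"
  by (simp add: cube_flow_def prod_nonneg)

lemma cube_flow_pos: "0 < s \<Longrightarrow> 0 < cube_flow s x"
  by (simp add: cube_flow_def prod_pos slab_pos)

lemma heat_kernel_eq:
  fixes x :: "'a::euclidean_space"
  assumes "0 < s"
  shows "heat_kernel s x = exp (- (norm x)\<^sup>2 / (4 * s)) / sqrt (4 * pi * s) ^ DIM('a)"
proof -
  have "(norm x)\<^sup>2 = (\<Sum>b\<in>Basis. (x \<bullet> b)\<^sup>2)"
    unfolding power2_norm_eq_inner by (subst euclidean_inner) (simp add: power2_eq_square)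
  then have "(\<Prod>b\<in>Basis. exp (- (x \<bullet> b)\<^sup>2 / (4 * s))) = exp (- (norm x)\<^sup>2 / (4 * s))"
    by (subst exp_sum[symmetric]) (auto simp: sum_negf sum_divide_distrib)
  then show ?thesis using assms
    by (simp add: heat_kernel_def heat_def prod_dividef)
qed

lemma prod_le_factor:
  fixes f :: "'b \<Rightarrow> real"
  assumes "finite A" "i \<in> A" "\<And>j. j \<in> A \<Longrightarrow> 0 \<le> f j" "\<And>j. j \<in> A \<Longrightarrow> f j \<le> 1"
  shows "prod f A \<le> f i"
proof -
  have "prod f A = f i * prod f (A - {i})" using assms(1,2) by (rule prod.remove)
  also have "\<dots> \<le> f i * 1" using assms by (intro mult_left_mono prod_le_1) auto
  finally show ?thesis by simp
qed

lemma cube_flow_le_slab: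
  assumes "0 < s" "b \<in> Basis" shows "cube_flow s x \<le> slab s (x \<bullet> b)"
  unfolding cube_flow_def using assms by (intro prod_le_factor) (auto simp: slab_le_1)

lemma cube_flow_le_1: "0 < s \<Longrightarrow> cube_flow s x \<le> 1"
  unfolding cube_flow_def by (intro prod_le_1) (auto simp: slab_le_1)

text \<open>
  One factor of the product is at most \<open>1 / sqrt s\<close>. This decay holds in every dimension and suffices
  below, because the exponent \<open>\<beta>\<close> is less than \<open>1 / 2\<close>.
\<close>

lemma cube_flow_le:
  assumes "0 < s" shows "cube_flow s x \<le> 1 / sqrt s"
proof -
  obtain b :: 'a where b: "b \<in> Basis" using nonempty_Basis by blast
  have "slab s (x \<bullet> b) \<le> 1 / sqrt s" using assms by (intro slab_le heat_le) auto
  with cube_flow_le_slab[OF assms b] show ?thesis by (rule order_trans)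
qed

lemma continuous_cube_flow: "continuous_on A (cube_flow s)"
proof -
  have "continuous_on UNIV (slab s)"
    using DERIV_isCont[OF slab_has_derivative] by (simp add: continuous_on_eq_continuous_at)
  then have "continuous_on A (\<lambda>x. slab s (x \<bullet> b))" for b
    by (rule continuous_on_compose2) (auto intro: continuous_on_inner)
  then show ?thesis unfolding cube_flow_def[abs_def]
    by (rule continuous_on_prod)
qed

lemma nn_integral_cube_flow:
  assumes "0 < s" shows "(\<integral>\<^sup>+ x. ennreal (cube_flow s (x :: 'a::euclidean_space)) \<partial>lborel) = 1"
proof -
  have "(\<integral>\<^sup>+ x. ennreal (cube_flow s (x :: 'a)) \<partial>lborel)
      = (\<integral>\<^sup>+ (x::'a). (\<Prod>b\<in>Basis. ennreal (slab s (x \<bullet> b))) \<partial>lborel)"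
    by (simp add: cube_flow_def prod_ennreal)
  also have "\<dots> = 1" using assms by (subst nn_integral_lborel_prod) (auto simp: nn_integral_slab)
  finally show ?thesis .
qed

lemma cube_flow_convolution:
  fixes x :: "'a::euclidean_space"
  assumes "0 < s" "0 < r"
  shows "(\<integral>\<^sup>+ y. ennreal (cube_flow s y * heat_kernel r (x - y)) \<partial>lborel) = ennreal (cube_flow (s + r) x)"
proof -
  have "(\<integral>\<^sup>+ y. ennreal (cube_flow s y * heat_kernel r (x - y)) \<partial>lborel)
      = (\<integral>\<^sup>+ y. (\<Prod>b\<in>Basis. ennreal (slab s (y \<bullet> b) * heat r (x \<bullet> b - y \<bullet> b))) \<partial>lborel)"
    by (simp add: cube_flow_def heat_kernel_def prod_ennreal prod.distrib inner_diff_left)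
  also have "\<dots> = (\<Prod>b\<in>Basis. ennreal (slab (s + r) (x \<bullet> b)))"
    using assms by (subst nn_integral_lborel_prod) (auto simp: slab_convolution)
  also have "\<dots> = ennreal (cube_flow (s + r) x)"
    by (simp add: cube_flow_def prod_ennreal)
  finally show ?thesis .
qed

lemma cube_flow_has_partial:
  fixes x b :: "'a::euclidean_space"
  assumes b: "b \<in> Basis"
  shows "((\<lambda>t. cube_flow s (x + t *\<^sub>R b)) has_real_derivative cube_flow_partial b s (x + t *\<^sub>R b)) (at t)"
proof -
  define P where "P = (\<Prod>b'\<in>Basis - {b}. slab s (x \<bullet> b'))"
  have P: "(\<Prod>b'\<in>Basis - {b}. slab s ((x + t *\<^sub>R b) \<bullet> b')) = P" for t
    unfolding P_def using b by (intro prod.cong) (auto simp: inner_simps inner_Basis)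
  have i: "(x + t *\<^sub>R b) \<bullet> b = x \<bullet> b + t" for t
    using b by (simp add: inner_simps)
  have "(\<lambda>t. cube_flow s (x + t *\<^sub>R b)) = (\<lambda>t. slab s (x \<bullet> b + t) * P)"
    unfolding cube_flow_def using b by (subst prod.remove[of _ b]) (auto simp: P i)
  moreover have "((\<lambda>t. slab s (x \<bullet> b + t)) has_real_derivative
      heat s (x \<bullet> b + t) - heat s (x \<bullet> b + t - 1)) (at t)"
    using DERIV_shift[THEN iffD1, OF slab_has_derivative[of s "t + x \<bullet> b"]]
    by (simp add: add.commute)
  then have "((\<lambda>t. slab s (x \<bullet> b + t) * P) has_real_derivative
      (heat s (x \<bullet> b + t) - heat s (x \<bullet> b + t - 1)) * P) (at t)"
    by (rule DERIV_cmult_right)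
  ultimately show ?thesis
    unfolding cube_flow_partial_def P i by simp
qed

lemma abs_cube_flow_partial_le:
  assumes "0 < s" shows "\<bar>cube_flow_partial b s x\<bar> \<le> 1 / sqrt s"
proof -
  have "\<bar>heat s (x \<bullet> b) - heat s (x \<bullet> b - 1)\<bar> \<le> 1 / sqrt s"
    using heat_le[OF assms, of "x \<bullet> b"] heat_le[OF assms, of "x \<bullet> b - 1"]
      heat_nonneg[of s "x \<bullet> b"] heat_nonneg[of s "x \<bullet> b - 1"] by linarith
  moreover have "\<bar>\<Prod>b'\<in>Basis - {b}. slab s (x \<bullet> b')\<bar> \<le> 1"
    using assms by (auto simp: prod_nonneg intro!: prod_le_1 slab_le_1)
  ultimately have "\<bar>heat s (x \<bullet> b) - heat s (x \<bullet> b - 1)\<bar> * \<bar>\<Prod>b'\<in>Basis - {b}. slab s (x \<bullet> b')\<bar> \<le> 1 / sqrt s * 1"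
    using assms by (intro mult_mono) auto
  then show ?thesis by (simp add: cube_flow_partial_def abs_mult)
qed

text \<open>
  The perimeter bound: each of the two faces contributes mass at most \<open>1\<close>, whatever the time \<open>s\<close>.
\<close>

lemma nn_integral_abs_cube_flow_partial:
  fixes b :: "'a::euclidean_space"
  assumes "0 < s" "b \<in> Basis"
  shows "(\<integral>\<^sup>+ x. ennreal \<bar>cube_flow_partial b s x\<bar> \<partial>lborel) \<le> 2"
proof -
  define f where "f b' t = (if b' = b then \<bar>heat s t - heat s (t - 1)\<bar> else slab s t)" for b' t
  have "\<bar>cube_flow_partial b s x\<bar> = (\<Prod>b'\<in>Basis. f b' (x \<bullet> b'))" for x
  proof -
    have "(\<Prod>b'\<in>Basis. f b' (x \<bullet> b')) = f b (x \<bullet> b) * (\<Prod>b'\<in>Basis - {b}. f b' (x \<bullet> b'))"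
      using assms(2) by (intro prod.remove) auto
    also have "(\<Prod>b'\<in>Basis - {b}. f b' (x \<bullet> b')) = (\<Prod>b'\<in>Basis - {b}. slab s (x \<bullet> b'))"
      by (intro prod.cong) (auto simp: f_def)
    finally show ?thesis by (simp add: cube_flow_partial_def f_def abs_mult prod_nonneg)
  qed
  then have "(\<integral>\<^sup>+ x. ennreal \<bar>cube_flow_partial b s x\<bar> \<partial>lborel)
      = (\<integral>\<^sup>+ (x::'a). (\<Prod>b'\<in>Basis. ennreal (f b' (x \<bullet> b'))) \<partial>lborel)"
    by (simp add: prod_ennreal f_def)
  also have "\<dots> = (\<Prod>b'\<in>Basis. \<integral>\<^sup>+ t. ennreal (f b' t) \<partial>lborel)"
    by (subst nn_integral_lborel_prod) (auto simp: f_def)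
  also have "\<dots> = (\<integral>\<^sup>+ t. ennreal (f b t) \<partial>lborel) * (\<Prod>b'\<in>Basis - {b}. \<integral>\<^sup>+ t. ennreal (f b' t) \<partial>lborel)"
    using assms(2) by (intro prod.remove) auto
  also have "(\<Prod>b'\<in>Basis - {b}. \<integral>\<^sup>+ t. ennreal (f b' t) \<partial>lborel) = 1"
    using assms(1) by (intro prod.neutral) (auto simp: f_def nn_integral_slab)
  also have "(\<integral>\<^sup>+ t. ennreal (f b t) \<partial>lborel)
      \<le> (\<integral>\<^sup>+ t. ennreal (heat s t) + ennreal (heat s (t - 1)) \<partial>lborel)"
    by (intro nn_integral_mono) (auto simp: f_def ennreal_plus[symmetric] simp del: ennreal_plus
      intro!: ennreal_leI abs_triangle_ineq4[THEN order_trans])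
  also have "\<dots> = 2"
    using assms(1) by (subst nn_integral_add) (auto simp: nn_integral_heat nn_integral_heat_translate)
  finally show ?thesis by simp
qed

section \<open>Superpositions and integration by parts\<close>

lemma nn_integral_powr_0:
  assumes "-1 < e" "0 \<le> c"
  shows "(\<integral>\<^sup>+ x. ennreal (x powr e) * indicator {0..c} x \<partial>lborel) = ennreal (c powr (e + 1) / (e + 1))"
proof -
  have "((\<lambda>x. x powr e * indicator {0..c} x) has_integral (c powr (e + 1) / (e + 1))) UNIV"
    by (rule has_integral_restrict_UNIV[THEN iffD2, THEN has_integral_eq_rhs, THEN has_integral_eq[rotated]])
       (auto intro: has_integral_powr_from_0[OF assms] simp: indicator_def)
  then have "(\<integral>\<^sup>+ x. ennreal (x powr e * indicator {0..c} x) \<partial>lborel) = ennreal (c powr (e + 1) / (e + 1))"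
    by (intro nn_integral_has_integral_lborel) auto
  then show ?thesis by (simp add: ennreal_mult'' ennreal_indicator)
qed

lemma nn_integral_powr_tail:
  assumes "e < -1" "0 < c"
  shows "(\<integral>\<^sup>+ x. ennreal (x powr e) * indicator {c..} x \<partial>lborel) = ennreal (- (c powr (e + 1)) / (e + 1))"
proof -
  have "((\<lambda>x. x powr e * indicator {c..} x) has_integral (- (c powr (e + 1)) / (e + 1))) UNIV"
    by (rule has_integral_restrict_UNIV[THEN iffD2, THEN has_integral_eq_rhs, THEN has_integral_eq[rotated]])
       (use has_integral_powr_to_inf[OF assms] in \<open>auto simp: indicator_def\<close>)
  then have "(\<integral>\<^sup>+ x. ennreal (x powr e * indicator {c..} x) \<partial>lborel) = ennreal (- (c powr (e + 1)) / (e + 1))"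
    by (intro nn_integral_has_integral_lborel) auto
  then show ?thesis by (simp add: ennreal_mult'' ennreal_indicator)
qed

text \<open>
  The functions and gradients below are superpositions \<open>\<integral> m t * k t x dt\<close> of a family that is bounded in \<open>L\<^sup>1\<close>, with an
  integrable weight \<open>m\<close>. Tonelli's theorem gives joint integrability; the bound is required only where
  the weight does not vanish, since the families below are bounded for positive times only, or only for
  times bounded away from \<open>0\<close>.
\<close>

lemma superposition_product_integrable:
  fixes m :: "real \<Rightarrow> real" and k :: "real \<Rightarrow> 'a::euclidean_space \<Rightarrow> real"
  assumes m: "integrable lborel m"
    and k: "(\<lambda>(t, x). k t x) \<in> borel_measurable (borel \<Otimes>\<^sub>M borel)"
    and M: "0 \<le> M" "\<And>t. m t \<noteq> 0 \<Longrightarrow> (\<integral>\<^sup>+ x. ennreal \<bar>k t x\<bar> \<partial>lborel) \<le> ennreal M"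
  shows "integrable (lborel \<Otimes>\<^sub>M lborel) (\<lambda>(t, x). m t * k t x)"
proof (rule integrableI_bounded)
  note [measurable] = k borel_measurable_integrable[OF m]
  show meas: "(\<lambda>(t, x). m t * k t x) \<in> borel_measurable (lborel \<Otimes>\<^sub>M lborel)"
    by measurable
  have "(\<integral>\<^sup>+ p. ennreal (norm (case p of (t, x) \<Rightarrow> m t * k t x)) \<partial>(lborel \<Otimes>\<^sub>M lborel))
      = (\<integral>\<^sup>+ t. (\<integral>\<^sup>+ x. ennreal \<bar>m t\<bar> * ennreal \<bar>k t x\<bar> \<partial>lborel) \<partial>lborel)"
    by (subst lborel.nn_integral_fst[symmetric]) (auto simp: abs_mult ennreal_mult)
  also have "\<dots> \<le> (\<integral>\<^sup>+ t. ennreal \<bar>m t\<bar> * ennreal M \<partial>lborel)"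
  proof (intro nn_integral_mono)
    fix t
    have "(\<integral>\<^sup>+ x. ennreal \<bar>m t\<bar> * ennreal \<bar>k t x\<bar> \<partial>lborel) = ennreal \<bar>m t\<bar> * (\<integral>\<^sup>+ x. ennreal \<bar>k t x\<bar> \<partial>lborel)"
      by (intro nn_integral_cmult) measurable
    also have "\<dots> \<le> ennreal \<bar>m t\<bar> * ennreal M"
      using M(2)[of t] by (cases "m t = 0") (auto intro: mult_left_mono)
    finally show "(\<integral>\<^sup>+ x. ennreal \<bar>m t\<bar> * ennreal \<bar>k t x\<bar> \<partial>lborel) \<le> ennreal \<bar>m t\<bar> * ennreal M" .
  qed
  also have "\<dots> = (\<integral>\<^sup>+ t. ennreal (norm (m t)) \<partial>lborel) * ennreal M"
    by (subst nn_integral_multc) auto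
  also have "\<dots> < \<infinity>"
    using m by (auto simp: integrable_iff_bounded ennreal_mult_less_top)
  finally show "(\<integral>\<^sup>+ p. ennreal (norm (case p of (t, x) \<Rightarrow> m t * k t x)) \<partial>(lborel \<Otimes>\<^sub>M lborel)) < \<infinity>" .
qed

lemma
  fixes m :: "real \<Rightarrow> real" and k :: "real \<Rightarrow> 'a::euclidean_space \<Rightarrow> real"
  assumes m: "integrable lborel m"
    and k: "(\<lambda>(t, x). k t x) \<in> borel_measurable (borel \<Otimes>\<^sub>M borel)"
    and M: "0 \<le> M" "\<And>t. m t \<noteq> 0 \<Longrightarrow> (\<integral>\<^sup>+ x. ennreal \<bar>k t x\<bar> \<partial>lborel) \<le> ennreal M"
  shows superposition_integrable: "integrable lborel (\<lambda>x. LINT t|lborel. m t * k t x)"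
    and superposition_swap:
      "(LINT x|lborel. LINT t|lborel. m t * k t x) = (LINT t|lborel. m t * (LINT x|lborel. k t x))"
    and superposition_norm:
      "(LINT x|lborel. \<bar>LINT t|lborel. m t * k t x\<bar>) \<le> M * (LINT t|lborel. \<bar>m t\<bar>)"
proof -
  note P = superposition_product_integrable[OF assms]
  show i: "integrable lborel (\<lambda>x. LINT t|lborel. m t * k t x)"
    using lborel_pair.integrable_snd[OF P] .
  show "(LINT x|lborel. LINT t|lborel. m t * k t x) = (LINT t|lborel. m t * (LINT x|lborel. k t x))"
    using lborel_pair.Fubini_integral[OF P] by simp
  have Pn: "integrable (lborel \<Otimes>\<^sub>M lborel) (\<lambda>(t, x). \<bar>m t * k t x\<bar>)"
    using integrable_abs[OF P] by (simp add: case_prod_beta')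
  have "(LINT x|lborel. \<bar>LINT t|lborel. m t * k t x\<bar>) \<le> (LINT x|lborel. LINT t|lborel. \<bar>m t * k t x\<bar>)"
    using lborel_pair.integrable_snd[OF Pn] by (intro integral_mono integrable_abs i integral_abs_bound)
  also have "\<dots> = (LINT t|lborel. LINT x|lborel. \<bar>m t * k t x\<bar>)"
    using lborel_pair.Fubini_integral[OF Pn] .
  also have "\<dots> \<le> (LINT t|lborel. \<bar>m t\<bar> * M)"
  proof (intro integral_mono)
    show "integrable lborel (\<lambda>t. LINT x|lborel. \<bar>m t * k t x\<bar>)"
      using lborel_pair.integrable_fst[OF Pn] .
    show "integrable lborel (\<lambda>t. \<bar>m t\<bar> * M)" using m by auto
    fix t
    show "(LINT x|lborel. \<bar>m t * k t x\<bar>) \<le> \<bar>m t\<bar> * M"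
    proof (cases "m t = 0")
      case False
      note [measurable] = k
      have "(LINT x|lborel. \<bar>k t x\<bar>) \<le> M"
        using M False by (intro integral_real_bounded) auto
      then show ?thesis by (simp add: abs_mult mult_left_mono)
    qed simp
  qed
  also have "\<dots> = M * (LINT t|lborel. \<bar>m t\<bar>)" by simp
  finally show "(LINT x|lborel. \<bar>LINT t|lborel. m t * k t x\<bar>) \<le> M * (LINT t|lborel. \<bar>m t\<bar>)" .
qed

lemma lborel_integral_translate:
  fixes f :: "'a::euclidean_space \<Rightarrow> real"
  assumes [measurable]: "f \<in> borel_measurable borel"
  shows "(LINT x|lborel. f (c + x)) = (LINT x|lborel. f x)"
  by (subst (2) lborel_distr_plus[symmetric, of c]) (simp add: integral_distr)

text \<open>
  The difference quotients of \<open>F\<close> have integral \<open>0\<close> by translation invariance, and they are dominated by a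
  multiple of the indicator of a ball, because \<open>F\<close> is Lipschitz along \<open>b\<close> and vanishes far away.
\<close>

lemma integral_directional_derivative_eq_0:
  fixes F F' :: "'a::euclidean_space \<Rightarrow> real"
  assumes F: "integrable lborel F" and F' [measurable]: "F' \<in> borel_measurable borel"
    and D: "\<And>x t. ((\<lambda>t. F (x + t *\<^sub>R b)) has_real_derivative F' (x + t *\<^sub>R b)) (at t)"
    and M: "\<And>x. \<bar>F' x\<bar> \<le> M" and R: "\<And>x. R \<le> norm x \<Longrightarrow> F x = 0"
  shows "(LINT x|lborel. F' x) = 0"
proof -
  have [measurable]: "F \<in> borel_measurable borel" using F by auto
  define h where "h n = inverse (real (Suc n))" for n
  have h: "0 < h n" "h n \<le> 1" for n by (auto simp: h_def inverse_le_1_iff)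
  define Q where "Q n x = (F (h n *\<^sub>R b + x) - F x) / h n" for n x
  have [measurable]: "Q n \<in> borel_measurable borel" for n unfolding Q_def by measurable
  have lim: "(\<lambda>n. Q n x) \<longlonglongrightarrow> F' x" for x
  proof -
    have "((\<lambda>t. (F (x + t *\<^sub>R b) - F x) / t) \<longlongrightarrow> F' x) (at 0)"
      using D[of x 0] by (simp add: has_field_derivative_iff)
    moreover have "filterlim h (at 0) sequentially"
      unfolding h_def[abs_def] filterlim_at using LIMSEQ_inverse_real_of_nat by auto
    ultimately have "(\<lambda>n. (F (x + h n *\<^sub>R b) - F x) / h n) \<longlonglongrightarrow> F' x"
      by (rule filterlim_compose)
    then show ?thesis by (simp add: Q_def add.commute)
  qed
  have bound: "\<bar>Q n x\<bar> \<le> M * indicator (cball 0 (R + norm b)) x" for n x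
  proof (cases "x \<in> cball 0 (R + norm b)")
    case True
    obtain z where "0 < z" "z < h n" "F (x + h n *\<^sub>R b) - F (x + 0 *\<^sub>R b) = (h n - 0) * F' (x + z *\<^sub>R b)"
      using MVT2[of 0 "h n" "\<lambda>t. F (x + t *\<^sub>R b)" "\<lambda>t. F' (x + t *\<^sub>R b)"] D h(1)[of n] by blast
    then have "Q n x = F' (x + z *\<^sub>R b)"
      using h(1)[of n] by (simp add: Q_def add.commute)
    then show ?thesis using True M by simp
  next
    case False
    then have n: "R + norm b < norm x" by simp
    have "norm (h n *\<^sub>R b) \<le> norm b" using h[of n] by (simp add: mult_left_le_one_le)
    then have "R \<le> norm (h n *\<^sub>R b + x)"
      using n norm_triangle_ineq4[of "h n *\<^sub>R b + x" "h n *\<^sub>R b"] by simp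
    moreover have "R \<le> norm x" using n norm_ge_zero[of b] by linarith
    ultimately show ?thesis using False by (simp add: Q_def R)
  qed
  have zero: "(LINT x|lborel. Q n x) = 0" for n
  proof -
    have i: "integrable lborel (\<lambda>x. F (h n *\<^sub>R b + x))"
      using F by (subst (asm) lborel_distr_plus[symmetric, of "h n *\<^sub>R b"]) (simp add: integrable_distr_eq)
    show ?thesis unfolding Q_def
      using F i by (simp add: lborel_integral_translate)
  qed
  have "(\<lambda>n. LINT x|lborel. Q n x) \<longlonglongrightarrow> (LINT x|lborel. F' x)"
  proof (rule integral_dominated_convergence)
    show "integrable lborel (\<lambda>x::'a. M * indicator (cball 0 (R + norm b)) x)"
      by (intro integrable_mult_right integrable_real_indicator) (use emeasure_lborel_cball_finite[where 'a = 'a] in auto)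
  qed (use lim bound in auto)
  then show ?thesis by (simp add: zero LIMSEQ_const_iff)
qed


lemma integration_by_parts_direction:
  fixes f f' g g' :: "'a::euclidean_space \<Rightarrow> real"
  assumes meas [measurable]: "f \<in> borel_measurable borel" "f' \<in> borel_measurable borel"
      "g \<in> borel_measurable borel" "g' \<in> borel_measurable borel"
    and Df: "\<And>x t. ((\<lambda>t. f (x + t *\<^sub>R b)) has_real_derivative f' (x + t *\<^sub>R b)) (at t)"
    and Dg: "\<And>x t. ((\<lambda>t. g (x + t *\<^sub>R b)) has_real_derivative g' (x + t *\<^sub>R b)) (at t)"
    and bf: "\<And>x. \<bar>f x\<bar> \<le> A" "\<And>x. \<bar>f' x\<bar> \<le> A"
    and bg: "\<And>x. \<bar>g x\<bar> \<le> B" "\<And>x. \<bar>g' x\<bar> \<le> B"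
    and R: "\<And>x. R \<le> norm x \<Longrightarrow> g x = 0" "\<And>x. R \<le> norm x \<Longrightarrow> g' x = 0"
  shows "(LINT x|lborel. f x * g' x) = - (LINT x|lborel. f' x * g x)"
proof -
  have int: "integrable lborel (\<lambda>x. p x * q x)"
    if "\<And>x. \<bar>p x\<bar> \<le> A" "\<And>x. \<bar>q x\<bar> \<le> B" "\<And>x. R \<le> norm x \<Longrightarrow> q x = 0"
      and [measurable]: "p \<in> borel_measurable borel" "q \<in> borel_measurable borel"
    for p q :: "'a \<Rightarrow> real"
  proof (rule Bochner_Integration.integrable_bound)
    show "integrable lborel (\<lambda>x::'a. A * B * indicator (cball 0 R) x)"
      by (intro integrable_mult_right integrable_real_indicator)
         (use emeasure_lborel_cball_finite[where 'a = 'a] in auto)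
    have "\<bar>p x * q x\<bar> \<le> A * B * indicator (cball 0 R) x" for x
    proof (cases "x \<in> cball 0 R")
      case True
      have "\<bar>p x\<bar> * \<bar>q x\<bar> \<le> A * B"
        using that(1,2)[of x] by (intro mult_mono) auto
      then show ?thesis using True by (simp add: abs_mult)
    qed (use that(3)[of x] in auto)
    then show "AE x in lborel. norm (p x * q x) \<le> norm (A * B * indicator (cball 0 R) x)"
      by (intro AE_I2) (metis abs_ge_self order_trans real_norm_def)
  qed measurable
  have i: "integrable lborel (\<lambda>x. f x * g' x)" "integrable lborel (\<lambda>x. f' x * g x)"
      "integrable lborel (\<lambda>x. f x * g x)"
    by (rule int; use bf bg R in auto)+
  have "(LINT x|lborel. f' x * g x + f x * g' x) = 0"
  proof (rule integral_directional_derivative_eq_0[OF i(3)])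
    show "((\<lambda>t. f (x + t *\<^sub>R b) * g (x + t *\<^sub>R b)) has_real_derivative
        f' (x + t *\<^sub>R b) * g (x + t *\<^sub>R b) + f (x + t *\<^sub>R b) * g' (x + t *\<^sub>R b)) (at t)" for x t
      using DERIV_mult[OF Df Dg] by (simp add: mult.commute)
    show "\<bar>f' x * g x + f x * g' x\<bar> \<le> A * B + A * B" for x
    proof -
      have "\<bar>f' x\<bar> * \<bar>g x\<bar> \<le> A * B" "\<bar>f x\<bar> * \<bar>g' x\<bar> \<le> A * B"
        using bf[of x] bg[of x] by (auto intro!: mult_mono)
      then show ?thesis by (intro abs_triangle_ineq[THEN order_trans]) (simp add: abs_mult)
    qed
  qed (use R in auto)
  then show ?thesis using i by simp
qed

text \<open>
  What integration by parts needs of a test field: its diagonal partial derivatives exist, and they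
  and the components are continuous, bounded and of bounded support.
\<close>

lemma test_field_component:
  fixes \<Phi> :: "'a::euclidean_space \<Rightarrow> 'a"
  assumes \<Phi>: "test_field \<Phi>"
  obtains R B where
    "\<And>x t. ((\<lambda>t. \<Phi> (x + t *\<^sub>R b) \<bullet> b) has_real_derivative
        frechet_derivative \<Phi> (at (x + t *\<^sub>R b)) b \<bullet> b) (at t)"
    "continuous_on UNIV (\<lambda>x. \<Phi> x \<bullet> b)"
    "continuous_on UNIV (\<lambda>x. frechet_derivative \<Phi> (at x) b \<bullet> b)"
    "\<And>x. \<bar>\<Phi> x \<bullet> b\<bar> \<le> B" "\<And>x. \<bar>frechet_derivative \<Phi> (at x) b \<bullet> b\<bar> \<le> B"
    "\<And>x. R \<le> norm x \<Longrightarrow> \<Phi> x \<bullet> b = 0"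
    "\<And>x. R \<le> norm x \<Longrightarrow> frechet_derivative \<Phi> (at x) b \<bullet> b = 0"
proof -
  define g where "g x = \<Phi> x \<bullet> b" for x
  define g' where "g' x = frechet_derivative \<Phi> (at x) b \<bullet> b" for x
  have Ck: "Ck 0 \<Phi>" "Ck 1 \<Phi>" and comp: "compact (closure {x. \<Phi> x \<noteq> 0})"
    using \<Phi> by (auto simp: test_field_def)
  have d: "(\<Phi> has_derivative frechet_derivative \<Phi> (at x)) (at x)" for x
    using Ck(2) by (simp add: frechet_derivative_works)
  have D: "((\<lambda>t. g (x + t *\<^sub>R b)) has_real_derivative g' (x + t *\<^sub>R b)) (at t)" for x t
  proof -
    have lin: "linear (frechet_derivative \<Phi> (at (x + t *\<^sub>R b)))"
      using d by (rule has_derivative_linear)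
    have "((\<lambda>t. x + t *\<^sub>R b) has_derivative (\<lambda>h. h *\<^sub>R b)) (at t)"
      by (auto intro!: derivative_eq_intros)
    from has_derivative_compose[OF this d]
    have "((\<lambda>t. \<Phi> (x + t *\<^sub>R b)) has_derivative (\<lambda>h. frechet_derivative \<Phi> (at (x + t *\<^sub>R b)) (h *\<^sub>R b))) (at t)" .
    then have "((\<lambda>t. \<Phi> (x + t *\<^sub>R b) \<bullet> b) has_derivative
        (\<lambda>h. frechet_derivative \<Phi> (at (x + t *\<^sub>R b)) (h *\<^sub>R b) \<bullet> b)) (at t)"
      by (rule has_derivative_inner_left)
    then show ?thesis
      by (simp add: has_field_derivative_def g_def g'_def linear_scale[OF lin] mult.commute[of _ "_ \<bullet> b"])
  qed
  have c: "continuous_on UNIV g" "continuous_on UNIV g'"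
    using Ck unfolding g_def g'_def by (auto intro!: continuous_on_inner)
  obtain R0 where R0: "\<And>x. x \<in> closure {x. \<Phi> x \<noteq> 0} \<Longrightarrow> norm x \<le> R0"
    using compact_imp_bounded[OF comp] by (auto simp: bounded_iff)
  have z: "\<Phi> x = 0" if "R0 < norm x" for x
    using R0[of x] that closure_subset[of "{x. \<Phi> x \<noteq> 0}"] by fastforce
  have z': "g' x = 0" if "R0 < norm x" for x
  proof -
    have "open {x::'a. R0 < norm x}" by (intro open_Collect_less continuous_intros)
    then have "(\<Phi> has_derivative (\<lambda>_. 0)) (at x)"
      using has_derivative_transform_within_open[of "\<lambda>_. 0" "\<lambda>_. 0" x UNIV "{x. R0 < norm x}" \<Phi>] z that
      by auto
    then have "frechet_derivative \<Phi> (at x) = (\<lambda>_. 0)" using d has_derivative_unique by blast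
    then show ?thesis by (simp add: g'_def)
  qed
  have bounded: "\<exists>B. \<forall>x. \<bar>q x\<bar> \<le> B" if "continuous_on UNIV q" "\<And>x. R0 < norm x \<Longrightarrow> q x = 0" for q :: "'a \<Rightarrow> real"
  proof -
    have "compact (q ` cball 0 R0)"
      by (rule compact_continuous_image[OF continuous_on_subset[OF that(1)]]) auto
    then obtain B where "\<forall>y\<in>q ` cball 0 R0. norm y \<le> B"
      using compact_imp_bounded bounded_iff by blast
    then have "\<bar>q x\<bar> \<le> max B 0" for x
      using that(2)[of x] by (cases "norm x \<le> R0") (simp_all add: le_max_iff_disj)
    then show ?thesis by blast
  qed
  obtain B1 B2 where B: "\<And>x. \<bar>g x\<bar> \<le> B1" "\<And>x. \<bar>g' x\<bar> \<le> B2"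
    using bounded[OF c(1)] bounded[OF c(2) z'] z by (auto simp: g_def)
  show thesis
  proof (rule that[of "max B1 B2" "R0 + 1"])
    show "\<bar>\<Phi> x \<bullet> b\<bar> \<le> max B1 B2" for x using B(1)[of x] by (simp add: g_def)
    show "\<bar>frechet_derivative \<Phi> (at x) b \<bullet> b\<bar> \<le> max B1 B2" for x
      using B(2)[of x] by (simp add: g'_def)
    show "\<Phi> x \<bullet> b = 0" if "R0 + 1 \<le> norm x" for x
      using z[of x] that by simp
    show "frechet_derivative \<Phi> (at x) b \<bullet> b = 0" if "R0 + 1 \<le> norm x" for x
      using z'[of x] that by (simp add: g'_def)
    show "((\<lambda>t. \<Phi> (x + t *\<^sub>R b) \<bullet> b) has_real_derivative
        frechet_derivative \<Phi> (at (x + t *\<^sub>R b)) b \<bullet> b) (at t)" for x t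
      using D[of x t] by (simp only: g_def g'_def)
  qed (use c in \<open>simp_all only: g_def[abs_def] g'_def[abs_def]\<close>)
qed

section \<open>Riesz potentials of superposed heat flows\<close>

text \<open>
  The kernel of the Riemann-Liouville fractional integral of order \<open>\<beta>\<close>, up to the factor \<open>1 / Gamma \<beta>\<close>.
\<close>

definition rl_kernel :: "real \<Rightarrow> real \<Rightarrow> real" where
  "rl_kernel \<beta> r = (if 0 < r then r powr (\<beta> - 1) else 0)"

lemma rl_kernel_measurable [measurable (raw)]:
  assumes [measurable]: "f \<in> borel_measurable M"
  shows "(\<lambda>x. rl_kernel \<beta> (f x)) \<in> borel_measurable M"
  unfolding rl_kernel_def by measurable

lemma rl_kernel_nonneg [simp]: "0 \<le> rl_kernel \<beta> r"
  by (simp add: rl_kernel_def)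

lemma rl_kernel_scale: "0 < c \<Longrightarrow> rl_kernel \<beta> (c * r) = c powr (\<beta> - 1) * rl_kernel \<beta> r"
  by (auto simp: rl_kernel_def powr_mult zero_less_mult_iff)

text \<open>
  Fractional integration of order \<open>\<beta>\<close> inverts fractional differentiation: the two kernels of orders
  \<open>1 - \<beta>\<close> and \<open>\<beta>\<close> are homogeneous with degrees adding up to \<open>-1\<close>, so their convolution is constant on
  the half-line. The constant is a Beta integral.
\<close>

lemma rl_kernel_convolution:
  assumes \<beta>: "0 < \<beta>" "\<beta> < 1"
  shows "has_bochner_integral lborel (\<lambda>s. rl_kernel (1 - \<beta>) (s - c) * rl_kernel \<beta> (\<tau> - s))
           (if c < \<tau> then Beta (1 - \<beta>) \<beta> else 0)"
proof -
  have "((\<lambda>t. t powr (1 - \<beta> - 1) * (1 - t) powr (\<beta> - 1)) has_integral Beta (1 - \<beta>) \<beta>) {0<..<1}"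
    using has_integral_Beta_real[of "1 - \<beta>" \<beta>] \<beta> by (simp add: has_integral_Icc_iff_Ioo)
  then have I: "((\<lambda>t. rl_kernel (1 - \<beta>) t * rl_kernel \<beta> (1 - t)) has_integral Beta (1 - \<beta>) \<beta>) UNIV"
    by (rule has_integral_on_superset[OF has_integral_eq[rotated]]) (auto simp: rl_kernel_def)
  have B: "0 \<le> Beta (1 - \<beta>) \<beta>"
    by (rule has_integral_nonneg[OF I]) simp
  have "(\<integral>\<^sup>+ t. ennreal (rl_kernel (1 - \<beta>) t * rl_kernel \<beta> (1 - t)) \<partial>lborel) = ennreal (Beta (1 - \<beta>) \<beta>)"
    by (rule nn_integral_has_integral_lborel[OF _ _ I]) auto
  show ?thesis
  proof (cases "c < \<tau>")
    case True
    have "(\<integral>\<^sup>+ s. ennreal (rl_kernel (1 - \<beta>) (s - c) * rl_kernel \<beta> (\<tau> - s)) \<partial>lborel)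
        = ennreal \<bar>\<tau> - c\<bar> * (\<integral>\<^sup>+ t. ennreal (rl_kernel (1 - \<beta>) (c + (\<tau> - c) * t - c)
            * rl_kernel \<beta> (\<tau> - (c + (\<tau> - c) * t))) \<partial>lborel)"
      using True by (intro nn_integral_real_affine) auto
    also have "\<dots> = (\<integral>\<^sup>+ t. ennreal (rl_kernel (1 - \<beta>) t * rl_kernel \<beta> (1 - t)) \<partial>lborel)"
    proof (subst nn_integral_cmult[symmetric], measurable, intro nn_integral_cong)
      fix t
      have "(\<tau> - c) * ((\<tau> - c) powr - \<beta> * (\<tau> - c) powr (\<beta> - 1)) = 1"
        using True by (simp add: powr_add[symmetric] powr_mult_base)
      moreover have "rl_kernel (1 - \<beta>) ((\<tau> - c) * t) = (\<tau> - c) powr - \<beta> * rl_kernel (1 - \<beta>) t"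
          "rl_kernel \<beta> ((\<tau> - c) * (1 - t)) = (\<tau> - c) powr (\<beta> - 1) * rl_kernel \<beta> (1 - t)"
        using True by (simp_all add: rl_kernel_scale)
      moreover have "(\<tau> - c) * (((\<tau> - c) powr - \<beta> * rl_kernel (1 - \<beta>) t) * ((\<tau> - c) powr (\<beta> - 1) * rl_kernel \<beta> (1 - t)))
          = ((\<tau> - c) * ((\<tau> - c) powr - \<beta> * (\<tau> - c) powr (\<beta> - 1))) * (rl_kernel (1 - \<beta>) t * rl_kernel \<beta> (1 - t))"
        by (simp only: mult_ac)
      ultimately have "(\<tau> - c) * (rl_kernel (1 - \<beta>) ((\<tau> - c) * t) * rl_kernel \<beta> ((\<tau> - c) * (1 - t)))
          = rl_kernel (1 - \<beta>) t * rl_kernel \<beta> (1 - t)"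
        by (simp only: mult_1)
      moreover have "\<tau> - (c + (\<tau> - c) * t) = (\<tau> - c) * (1 - t)" by (simp add: algebra_simps)
      ultimately show "ennreal \<bar>\<tau> - c\<bar> * ennreal (rl_kernel (1 - \<beta>) (c + (\<tau> - c) * t - c)
            * rl_kernel \<beta> (\<tau> - (c + (\<tau> - c) * t))) = ennreal (rl_kernel (1 - \<beta>) t * rl_kernel \<beta> (1 - t))"
        using True by (simp add: ennreal_mult'[symmetric])
    qed
    also have "\<dots> = ennreal (Beta (1 - \<beta>) \<beta>)" by fact
    finally show ?thesis using B True
      by (intro has_bochner_integral_nn_integral) auto
  next
    case False
    then have "(\<lambda>s. rl_kernel (1 - \<beta>) (s - c) * rl_kernel \<beta> (\<tau> - s)) = (\<lambda>s. 0)"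
      by (auto simp: rl_kernel_def)
    then show ?thesis using False by (simp add: has_bochner_integral_zero)
  qed
qed

text \<open>
  At infinity the integrand decays like \<open>r powr (\<beta> - 3 / 2)\<close>, which is integrable because \<open>\<beta> < 1 / 2\<close>.
\<close>

lemma rl_kernel_sqrt_finite:
  assumes \<beta>: "0 < \<beta>" "\<beta> < 1 / 2" and "0 < \<epsilon>"
  shows "(\<integral>\<^sup>+ r. ennreal (rl_kernel \<beta> r / sqrt (\<epsilon> + r)) \<partial>lborel) < \<infinity>"
proof -
  have "rl_kernel \<beta> r / sqrt (\<epsilon> + r) \<le> 1 / sqrt \<epsilon> * (r powr (\<beta> - 1) * indicator {0..1} r)
      + r powr (\<beta> - 3 / 2) * indicator {1..} r" for r
  proof -
    consider "r \<le> 0" | "0 < r" "r < 1" | "1 \<le> r" by linarith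
    then show ?thesis
    proof cases
      case 2
      have "1 / sqrt (\<epsilon> + r) \<le> 1 / sqrt \<epsilon>" using 2 assms by (intro divide_left_mono) auto
      then have "r powr (\<beta> - 1) * (1 / sqrt (\<epsilon> + r)) \<le> r powr (\<beta> - 1) * (1 / sqrt \<epsilon>)"
        by (intro mult_left_mono) auto
      then show ?thesis using 2 by (simp add: rl_kernel_def)
    next
      case 3
      have "1 / sqrt (\<epsilon> + r) \<le> 1 / sqrt r" using 3 assms by (intro divide_left_mono) auto
      then have "r powr (\<beta> - 1) * (1 / sqrt (\<epsilon> + r)) \<le> r powr (\<beta> - 1) * (1 / sqrt r)"
        by (intro mult_left_mono) auto
      also have "\<dots> = r powr (\<beta> - 3 / 2)"
        using 3 by (simp add: powr_half_sqrt[symmetric] powr_diff[symmetric])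
      finally have "rl_kernel \<beta> r / sqrt (\<epsilon> + r) \<le> r powr (\<beta> - 3 / 2) * indicator {1..} r"
        using 3 by (simp add: rl_kernel_def)
      also have "\<dots> \<le> 1 / sqrt \<epsilon> * (r powr (\<beta> - 1) * indicator {0..1} r)
          + r powr (\<beta> - 3 / 2) * indicator {1..} r"
        using assms by simp
      finally show ?thesis .
    qed (use assms in \<open>simp add: rl_kernel_def\<close>)
  qed
  then have "(\<integral>\<^sup>+ r. ennreal (rl_kernel \<beta> r / sqrt (\<epsilon> + r)) \<partial>lborel)
      \<le> (\<integral>\<^sup>+ r. ennreal (1 / sqrt \<epsilon>) * (ennreal (r powr (\<beta> - 1)) * indicator {0..1} r)
        + ennreal (r powr (\<beta> - 3 / 2)) * indicator {1..} r \<partial>lborel)"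
    using assms by (intro nn_integral_mono)
      (auto simp: ennreal_indicator[symmetric] ennreal_mult'[symmetric] ennreal_mult''[symmetric]
        ennreal_plus[symmetric] simp del: ennreal_plus intro!: ennreal_leI)
  also have "\<dots> < \<infinity>"
    using assms by (simp add: nn_integral_add nn_integral_cmult nn_integral_powr_0
      nn_integral_powr_tail ennreal_mult_less_top)
  finally show ?thesis .
qed

text \<open>
  The substitution \<open>r = (norm z)\<^sup>2 t\<close> extracts the power of \<open>norm z\<close>. Finiteness of \<open>K\<close> is
  deduced in \<open>riesz_convolution_cube_flow\<close>.
\<close>

lemma riesz_kernel_subordination:
  obtains K :: ennreal where "K \<noteq> 0"
    "\<And>z::'a::euclidean_space. z \<noteq> 0 \<Longrightarrow>
       (\<integral>\<^sup>+ r. ennreal (rl_kernel \<beta> r * heat_kernel r z) \<partial>lborel)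
         = K * ennreal (norm z powr (2 * \<beta> - real DIM('a)))"
proof -
  define p where "p t = rl_kernel \<beta> t * (exp (- 1 / (4 * t)) / sqrt (4 * pi * t) ^ DIM('a))" for t
  have [measurable]: "p \<in> borel_measurable borel" unfolding p_def by measurable
  have p0: "p t = 0" if "t \<le> 0" for t using that by (simp add: p_def rl_kernel_def)
  have ppos: "0 < p t" if "0 < t" for t using that by (simp add: p_def rl_kernel_def)
  have pnn: "0 \<le> p t" for t using p0[of t] ppos[of t] by (cases "0 < t") auto
  show thesis
  proof (rule that)
    show "(\<integral>\<^sup>+ t. ennreal (p t) \<partial>lborel) \<noteq> 0"
    proof
      assume "(\<integral>\<^sup>+ t. ennreal (p t) \<partial>lborel) = 0"
      then have "AE t in lborel. p t \<le> 0"
        by (subst (asm) nn_integral_0_iff_AE) (auto simp: ennreal_eq_0_iff)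
      then have "AE t in lborel. t \<notin> {0<..<1::real}"
        by eventually_elim (use ppos in force)
      then have "emeasure lborel {0<..<1::real} = 0"
        by (subst (asm) AE_iff_measurable[where N = "{0<..<1}"]) auto
      then show False by simp
    qed
    fix z :: 'a assume "z \<noteq> 0"
    define n where "n = norm z"
    have n: "0 < n" using \<open>z \<noteq> 0\<close> by (simp add: n_def)
    have "(\<integral>\<^sup>+ r. ennreal (rl_kernel \<beta> r * heat_kernel r z) \<partial>lborel)
        = ennreal \<bar>n\<^sup>2\<bar> * (\<integral>\<^sup>+ t. ennreal (rl_kernel \<beta> (0 + n\<^sup>2 * t) * heat_kernel (0 + n\<^sup>2 * t) z) \<partial>lborel)"
      using n by (intro nn_integral_real_affine) auto
    also have "\<dots> = (\<integral>\<^sup>+ t. ennreal (p t) * ennreal (n powr (2 * \<beta> - real DIM('a))) \<partial>lborel)"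
    proof (subst nn_integral_cmult[symmetric], measurable, intro nn_integral_cong)
      fix t
      have "n\<^sup>2 * (rl_kernel \<beta> (n\<^sup>2 * t) * heat_kernel (n\<^sup>2 * t) z) = p t * n powr (2 * \<beta> - real DIM('a))"
      proof (cases "0 < t")
        case True
        have h: "heat_kernel (n\<^sup>2 * t) z = exp (- 1 / (4 * t)) / (n * sqrt (4 * pi * t)) ^ DIM('a)"
          using True n by (subst heat_kernel_eq) (auto simp: n_def real_sqrt_mult mult_ac)
        have pw: "n\<^sup>2 * (n\<^sup>2) powr (\<beta> - 1) / n ^ DIM('a) = n powr (2 * \<beta> - real DIM('a))"
        proof -
          have "n\<^sup>2 = n powr 2" using n by (simp add: powr_numeral)
          then have "n\<^sup>2 * (n\<^sup>2) powr (\<beta> - 1) = n powr (2 * \<beta>)"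
            using n by (simp add: powr_powr powr_add[symmetric] algebra_simps del: powr_numeral)
          then show ?thesis using n by (simp add: powr_diff powr_realpow)
        qed
        have "rl_kernel \<beta> (n\<^sup>2 * t) = (n\<^sup>2) powr (\<beta> - 1) * rl_kernel \<beta> t"
          using n by (simp add: rl_kernel_scale)
        then show ?thesis unfolding h p_def pw[symmetric] power_mult_distrib by (simp add: mult_ac)
      next
        case False
        then have "n\<^sup>2 * t \<le> 0" using n by (simp add: mult_le_0_iff)
        then have "rl_kernel \<beta> (n\<^sup>2 * t) = 0" unfolding rl_kernel_def by auto
        then show ?thesis using False by (simp add: p0)
      qed
      then show "ennreal \<bar>n\<^sup>2\<bar> * ennreal (rl_kernel \<beta> (0 + n\<^sup>2 * t) * heat_kernel (0 + n\<^sup>2 * t) z)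
          = ennreal (p t) * ennreal (n powr (2 * \<beta> - real DIM('a)))"
        using n pnn[of t] by (simp add: ennreal_mult'[symmetric] ennreal_mult''[symmetric])
    qed
    also have "\<dots> = (\<integral>\<^sup>+ t. ennreal (p t) \<partial>lborel) * ennreal (n powr (2 * \<beta> - real DIM('a)))"
      by (intro nn_integral_multc) auto
    finally show "(\<integral>\<^sup>+ r. ennreal (rl_kernel \<beta> r * heat_kernel r z) \<partial>lborel)
        = (\<integral>\<^sup>+ t. ennreal (p t) \<partial>lborel) * ennreal (norm z powr (2 * \<beta> - real DIM('a)))"
      by (simp add: n_def)
  qed
qed


lemma nn_integral_rl_kernel_cube_flow_le:
  assumes "0 < \<epsilon>" "\<epsilon> \<le> s"
  shows "(\<integral>\<^sup>+ r. ennreal (rl_kernel \<beta> r * cube_flow (s + r) x) \<partial>lborel)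
    \<le> (\<integral>\<^sup>+ r. ennreal (rl_kernel \<beta> r / sqrt (\<epsilon> + r)) \<partial>lborel)"
proof (intro nn_integral_mono ennreal_leI)
  fix r
  show "rl_kernel \<beta> r * cube_flow (s + r) x \<le> rl_kernel \<beta> r / sqrt (\<epsilon> + r)"
  proof (cases "0 < r")
    case True
    have "cube_flow (s + r) x \<le> 1 / sqrt (s + r)" using True assms by (intro cube_flow_le) auto
    also have "\<dots> \<le> 1 / sqrt (\<epsilon> + r)" using True assms by (intro divide_left_mono) auto
    finally have "rl_kernel \<beta> r * cube_flow (s + r) x \<le> rl_kernel \<beta> r * (1 / sqrt (\<epsilon> + r))"
      by (rule mult_left_mono) simp
    then show ?thesis by simp
  qed (simp add: rl_kernel_def)
qed

text \<open>
  By subordination and the semigroup law, convolution with the Riesz kernel is the fractional integral in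
  time. If the subordination constant were infinite, the right-hand side would be infinite, too; but the
  decay of the flow in time makes it finite.
\<close>

lemma riesz_convolution_cube_flow:
  assumes \<beta>: "0 < \<beta>" "\<beta> < 1 / 2"
  obtains K where "0 < K"
    "\<And>s (x::'a::euclidean_space). 0 < s \<Longrightarrow>
      (\<integral>\<^sup>+ y. ennreal (cube_flow s y * norm (x - y) powr (2 * \<beta> - real DIM('a))) \<partial>lborel)
        = ennreal K * (\<integral>\<^sup>+ r. ennreal (rl_kernel \<beta> r * cube_flow (s + r) x) \<partial>lborel)"
proof -
  obtain L :: ennreal where L: "L \<noteq> 0" "\<And>z::'a. z \<noteq> 0 \<Longrightarrow>
      (\<integral>\<^sup>+ r. ennreal (rl_kernel \<beta> r * heat_kernel r z) \<partial>lborel) = L * ennreal (norm z powr (2 * \<beta> - real DIM('a)))"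
    using riesz_kernel_subordination[of \<beta>] by blast
  have eq: "L * (\<integral>\<^sup>+ y. ennreal (cube_flow s y * norm (x - y) powr (2 * \<beta> - real DIM('a))) \<partial>lborel)
      = (\<integral>\<^sup>+ r. ennreal (rl_kernel \<beta> r * cube_flow (s + r) x) \<partial>lborel)" if s: "0 < s" for s and x :: 'a
  proof -
    have "L * (\<integral>\<^sup>+ y. ennreal (cube_flow s y * norm (x - y) powr (2 * \<beta> - real DIM('a))) \<partial>lborel)
        = (\<integral>\<^sup>+ y. ennreal (cube_flow s y) * (L * ennreal (norm (x - y) powr (2 * \<beta> - real DIM('a)))) \<partial>lborel)"
      by (subst nn_integral_cmult[symmetric]) (auto simp: ennreal_mult' mult_ac)
    also have "\<dots> = (\<integral>\<^sup>+ y. ennreal (cube_flow s y) *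
        (\<integral>\<^sup>+ r. ennreal (rl_kernel \<beta> r * heat_kernel r (x - y)) \<partial>lborel) \<partial>lborel)"
    proof (rule nn_integral_cong_AE)
      show "AE y in lborel. ennreal (cube_flow s y) * (L * ennreal (norm (x - y) powr (2 * \<beta> - real DIM('a))))
        = ennreal (cube_flow s y) * (\<integral>\<^sup>+ r. ennreal (rl_kernel \<beta> r * heat_kernel r (x - y)) \<partial>lborel)"
        using AE_lborel_singleton[of x] by eventually_elim (simp add: L(2))
    qed
    also have "\<dots> = (\<integral>\<^sup>+ y. (\<integral>\<^sup>+ r. ennreal (rl_kernel \<beta> r) * ennreal (cube_flow s y * heat_kernel r (x - y)) \<partial>lborel) \<partial>lborel)"
      by (subst nn_integral_cmult[symmetric]) (auto simp: ennreal_mult' mult_ac)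
    also have "\<dots> = (\<integral>\<^sup>+ r. (\<integral>\<^sup>+ y. ennreal (rl_kernel \<beta> r) * ennreal (cube_flow s y * heat_kernel r (x - y)) \<partial>lborel) \<partial>lborel)"
      by (rule lborel_pair.Fubini') measurable
    also have "\<dots> = (\<integral>\<^sup>+ r. ennreal (rl_kernel \<beta> r * cube_flow (s + r) x) \<partial>lborel)"
    proof (rule nn_integral_cong)
      fix r
      have "(\<integral>\<^sup>+ y. ennreal (rl_kernel \<beta> r) * ennreal (cube_flow s y * heat_kernel r (x - y)) \<partial>lborel)
          = ennreal (rl_kernel \<beta> r) * (\<integral>\<^sup>+ y. ennreal (cube_flow s y * heat_kernel r (x - y)) \<partial>lborel)"
        by (intro nn_integral_cmult) measurable
      also have "\<dots> = ennreal (rl_kernel \<beta> r * cube_flow (s + r) x)"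
      proof (cases "0 < r")
        case True
        then show ?thesis by (simp only: cube_flow_convolution[OF s True] ennreal_mult'[OF rl_kernel_nonneg])
      qed (simp add: rl_kernel_def)
      finally show "(\<integral>\<^sup>+ y. ennreal (rl_kernel \<beta> r) * ennreal (cube_flow s y * heat_kernel r (x - y)) \<partial>lborel)
          = ennreal (rl_kernel \<beta> r * cube_flow (s + r) x)" .
    qed
    finally show ?thesis .
  qed
  \<comment> \<open>With \<open>L = \<infinity>\<close>, finiteness of the right-hand side of \<open>eq\<close> at \<open>s = 1\<close>, \<open>x = 0\<close> would force a positive integrand to vanish almost everywhere.\<close>
  have "L < \<infinity>"
  proof (rule ccontr)
    assume "\<not> L < \<infinity>"
    then have [simp]: "L = \<infinity>" by (simp add: less_top[symmetric])
    have "AE y in lborel. ennreal (cube_flow 1 y * norm ((0::'a) - y) powr (2 * \<beta> - real DIM('a))) = 0"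
    proof (subst nn_integral_0_iff_AE[symmetric])
      have "(\<integral>\<^sup>+ r. ennreal (rl_kernel \<beta> r * cube_flow (1 + r) (0::'a)) \<partial>lborel) < \<infinity>"
        using nn_integral_rl_kernel_cube_flow_le[of 1 1 \<beta> "0::'a"] rl_kernel_sqrt_finite[OF \<beta>, of 1] by simp
      then show "(\<integral>\<^sup>+ y. ennreal (cube_flow 1 y * norm ((0::'a) - y) powr (2 * \<beta> - real DIM('a))) \<partial>lborel) = 0"
        unfolding eq[of 1 "0::'a", OF zero_less_one, symmetric] by (auto simp: ennreal_top_mult split: if_splits)
    qed measurable
    moreover have "0 < cube_flow 1 y * norm (0 - y) powr (2 * \<beta> - real DIM('a))" if "y \<noteq> 0" for y :: 'a
      using that by (intro mult_pos_pos cube_flow_pos) auto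
    ultimately have "AE y in lborel. (y::'a) = 0"
      by (elim AE_mp) (auto simp: ennreal_eq_0_iff not_le[symmetric] simp del: diff_0)
    then have "AE y in lborel. (False \<and> y = (0::'a))"
      using AE_lborel_singleton[of "0::'a"] by eventually_elim simp
    then have "emeasure lborel (UNIV::'a set) = 0"
      by (subst (asm) AE_iff_measurable[OF _ refl]) auto
    then show False by simp
  qed
  then obtain l where l: "L = ennreal l" "0 < l" using L(1)
    by (cases L) (auto simp: less_le)
  show thesis
  proof (rule that[of "1 / l"])
    show "0 < 1 / l" using l by simp
    fix s :: real and x :: 'a assume s: "0 < s"
    have "ennreal (1 / l) * L = 1" using l by (simp add: ennreal_mult'[symmetric])
    then show "(\<integral>\<^sup>+ y. ennreal (cube_flow s y * norm (x - y) powr (2 * \<beta> - real DIM('a))) \<partial>lborel)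
        = ennreal (1 / l) * (\<integral>\<^sup>+ r. ennreal (rl_kernel \<beta> r * cube_flow (s + r) x) \<partial>lborel)"
      unfolding eq[OF s, symmetric] by (simp only: mult.assoc[symmetric] mult_1)
  qed
qed

text \<open>
  The Riesz potential acts on the weight of a superposition of heat flows, as the fractional
  integral of order \<open>\<beta>\<close>. The weight is kept away from time \<open>0\<close>, which makes the double integrals
  absolutely convergent.
\<close>

lemma riesz_potential_superposition:
  assumes \<beta>: "0 < \<beta>" "\<beta> < 1 / 2"
  obtains c where "\<And>a \<epsilon> (x::'a::euclidean_space). integrable lborel a \<Longrightarrow> 0 < \<epsilon> \<Longrightarrow> (\<And>s. a s \<noteq> 0 \<Longrightarrow> \<epsilon> \<le> s) \<Longrightarrow>
      riesz_potential (2 * \<beta>) (\<lambda>y. LINT s|lborel. a s * cube_flow s y) x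
        = c * (LINT \<tau>|lborel. (LINT s|lborel. a s * rl_kernel \<beta> (\<tau> - s)) * cube_flow \<tau> x)"
proof -
  obtain K where K: "0 < K" "\<And>s (x::'a). 0 < s \<Longrightarrow>
      (\<integral>\<^sup>+ y. ennreal (cube_flow s y * norm (x - y) powr (2 * \<beta> - real DIM('a))) \<partial>lborel)
        = ennreal K * (\<integral>\<^sup>+ r. ennreal (rl_kernel \<beta> r * cube_flow (s + r) x) \<partial>lborel)"
    using riesz_convolution_cube_flow[OF \<beta>, where 'a = 'a] by blast
  show thesis
  proof (rule that)
    fix a :: "real \<Rightarrow> real" and \<epsilon> :: real and x :: 'a
    assume a: "integrable lborel a" and \<epsilon>: "0 < \<epsilon>" and supp: "\<And>s. a s \<noteq> 0 \<Longrightarrow> \<epsilon> \<le> s"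
    obtain M where M: "0 \<le> M" "(\<integral>\<^sup>+ r. ennreal (rl_kernel \<beta> r / sqrt (\<epsilon> + r)) \<partial>lborel) = ennreal M"
      using rl_kernel_sqrt_finite[OF \<beta> \<epsilon>] by (cases "\<integral>\<^sup>+ r. ennreal (rl_kernel \<beta> r / sqrt (\<epsilon> + r)) \<partial>lborel") auto
    have tr: "(\<integral>\<^sup>+ \<tau>. ennreal (rl_kernel \<beta> (\<tau> - s) * cube_flow \<tau> x) \<partial>lborel)
        = (\<integral>\<^sup>+ r. ennreal (rl_kernel \<beta> r * cube_flow (s + r) x) \<partial>lborel)" for s
      by (subst nn_integral_real_affine[where c = 1 and t = s]) auto
    have bd: "(\<integral>\<^sup>+ \<tau>. ennreal \<bar>rl_kernel \<beta> (\<tau> - s) * cube_flow \<tau> x\<bar> \<partial>lborel) \<le> ennreal M" if "a s \<noteq> 0" for s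
      using nn_integral_rl_kernel_cube_flow_le[OF \<epsilon> supp[OF that], of \<beta> x] by (simp add: tr M abs_mult)
    have nn: "(\<integral>\<^sup>+ y. ennreal (cube_flow s y * norm (x - y) powr (2 * \<beta> - real DIM('a))) \<partial>lborel)
        = ennreal K * (\<integral>\<^sup>+ \<tau>. ennreal (rl_kernel \<beta> (\<tau> - s) * cube_flow \<tau> x) \<partial>lborel)" if "a s \<noteq> 0" for s
      using supp[OF that] \<epsilon> by (simp add: K tr)
    have "(LINT y|lborel. (LINT s|lborel. a s * cube_flow s y) / norm (x - y) powr (real DIM('a) - 2 * \<beta>))
        = (LINT y|lborel. (LINT s|lborel. a s * (cube_flow s y * norm (x - y) powr (2 * \<beta> - real DIM('a)))))"
    proof (rule Bochner_Integration.integral_cong[OF refl])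
      fix y
      have "norm (x - y) powr (2 * \<beta> - real DIM('a)) = inverse (norm (x - y) powr (real DIM('a) - 2 * \<beta>))"
        by (simp add: powr_minus[symmetric])
      then show "(LINT s|lborel. a s * cube_flow s y) / norm (x - y) powr (real DIM('a) - 2 * \<beta>)
          = (LINT s|lborel. a s * (cube_flow s y * norm (x - y) powr (2 * \<beta> - real DIM('a))))"
        by (simp add: divide_inverse mult.assoc[symmetric])
    qed
    also have "\<dots> = (LINT s|lborel. a s * (LINT y|lborel. cube_flow s y * norm (x - y) powr (2 * \<beta> - real DIM('a))))"
    proof (rule superposition_swap[OF a, where M = "K * M"])
      show "(\<integral>\<^sup>+ y. ennreal \<bar>cube_flow s y * norm (x - y) powr (2 * \<beta> - real DIM('a))\<bar> \<partial>lborel) \<le> ennreal (K * M)"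
        if "a s \<noteq> 0" for s
      proof -
        have "(\<integral>\<^sup>+ y. ennreal \<bar>cube_flow s y * norm (x - y) powr (2 * \<beta> - real DIM('a))\<bar> \<partial>lborel)
            = ennreal K * (\<integral>\<^sup>+ \<tau>. ennreal \<bar>rl_kernel \<beta> (\<tau> - s) * cube_flow \<tau> x\<bar> \<partial>lborel)"
          using nn[OF that] by (simp only: abs_mult abs_of_nonneg cube_flow_nonneg rl_kernel_nonneg powr_ge_zero)
        also have "\<dots> \<le> ennreal K * ennreal M" by (intro mult_left_mono bd that) simp
        finally show ?thesis using K(1) by (simp add: ennreal_mult')
      qed
    qed (use K M in auto)
    also have "\<dots> = (LINT s|lborel. a s * (K * (LINT \<tau>|lborel. rl_kernel \<beta> (\<tau> - s) * cube_flow \<tau> x)))"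
    proof (rule Bochner_Integration.integral_cong[OF refl])
      fix s
      show "a s * (LINT y|lborel. cube_flow s y * norm (x - y) powr (2 * \<beta> - real DIM('a)))
          = a s * (K * (LINT \<tau>|lborel. rl_kernel \<beta> (\<tau> - s) * cube_flow \<tau> x))"
        using K(1) by (cases "a s = 0") (simp_all add: integral_eq_nn_integral nn enn2real_mult)
    qed
    also have "\<dots> = K * (LINT s|lborel. a s * (LINT \<tau>|lborel. rl_kernel \<beta> (\<tau> - s) * cube_flow \<tau> x))"
      by (subst Bochner_Integration.integral_mult_right_zero[symmetric]) (simp add: mult_ac)
    also have "(LINT s|lborel. a s * (LINT \<tau>|lborel. rl_kernel \<beta> (\<tau> - s) * cube_flow \<tau> x))
        = (LINT \<tau>|lborel. LINT s|lborel. a s * (rl_kernel \<beta> (\<tau> - s) * cube_flow \<tau> x))"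
      by (rule superposition_swap[OF a _ M(1) bd, symmetric]) measurable
    also have "\<dots> = (LINT \<tau>|lborel. (LINT s|lborel. a s * rl_kernel \<beta> (\<tau> - s)) * cube_flow \<tau> x)"
      by (simp add: mult.assoc[symmetric])
    finally show "riesz_potential (2 * \<beta>) (\<lambda>y. LINT s|lborel. a s * cube_flow s y) x
        = (K / riesz_const DIM('a) (2 * \<beta>)) * (LINT \<tau>|lborel. (LINT s|lborel. a s * rl_kernel \<beta> (\<tau> - s)) * cube_flow \<tau> x)"
      by (simp add: riesz_potential_def)
  qed
qed

section \<open>Functions with bounded fractional variation\<close>

text \<open>
  The fractional derivative of order \<open>\<beta>\<close>, up to a constant factor, of the normalised indicator of
  \<open>(\<epsilon>, 2 \<epsilon>]\<close>. The difference of the two singular powers decays like \<open>s\<^bsup>-\<beta>-1\<^esup>\<close> and is integrable,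
  although neither of them is.
\<close>

definition abel_weight :: "real \<Rightarrow> real \<Rightarrow> real \<Rightarrow> real" where
  "abel_weight \<beta> \<epsilon> s = (rl_kernel (1 - \<beta>) (s - \<epsilon>) - rl_kernel (1 - \<beta>) (s - 2 * \<epsilon>)) / \<epsilon>"

lemma abel_weight_measurable [measurable]: "abel_weight \<beta> \<epsilon> \<in> borel_measurable borel"
  unfolding abel_weight_def[abs_def] by measurable

lemma abel_weight_support: "0 < \<epsilon> \<Longrightarrow> abel_weight \<beta> \<epsilon> s \<noteq> 0 \<Longrightarrow> \<epsilon> \<le> s"
  by (auto simp: abel_weight_def rl_kernel_def split: if_splits)

text \<open>
  Mean value theorem for \<open>x powr - \<beta>\<close> on \<open>[s - 2 * \<epsilon>, s - \<epsilon>]\<close>. The lower bound does not depend on \<open>\<epsilon>\<close>; it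
  is, up to a constant, the weight in the formula for \<open>(-\<Delta>)\<^sup>\<beta>\<close> in terms of the heat semigroup.
\<close>

lemma abel_weight_tail:
  assumes \<beta>: "0 < \<beta>" and \<epsilon>: "0 < \<epsilon>" and s: "2 * \<epsilon> < s"
  shows "\<beta> * s powr (- \<beta> - 1) \<le> - abel_weight \<beta> \<epsilon> s"
    and "- abel_weight \<beta> \<epsilon> s \<le> \<beta> * (s - 2 * \<epsilon>) powr (- \<beta> - 1)"
proof -
  have "((\<lambda>x. x powr - \<beta>) has_real_derivative - \<beta> * x powr (- \<beta> - 1)) (at x)" if "0 < x" for x
    using that by (auto intro!: derivative_eq_intros)
  then obtain z where z: "s - 2 * \<epsilon> < z" "z < s - \<epsilon>"
      "(s - \<epsilon>) powr - \<beta> - (s - 2 * \<epsilon>) powr - \<beta> = (s - \<epsilon> - (s - 2 * \<epsilon>)) * (- \<beta> * z powr (- \<beta> - 1))"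
    using MVT2[of "s - 2 * \<epsilon>" "s - \<epsilon>" "\<lambda>x. x powr - \<beta>" "\<lambda>x. - \<beta> * x powr (- \<beta> - 1)"] s \<epsilon> by auto
  have "- abel_weight \<beta> \<epsilon> s = \<beta> * z powr (- \<beta> - 1)"
    using z(3) s \<epsilon> by (simp add: abel_weight_def rl_kernel_def field_simps)
  moreover have "s powr (- \<beta> - 1) \<le> z powr (- \<beta> - 1)" "z powr (- \<beta> - 1) \<le> (s - 2 * \<epsilon>) powr (- \<beta> - 1)"
    using z s \<epsilon> \<beta> by (auto intro!: powr_mono2')
  ultimately show "\<beta> * s powr (- \<beta> - 1) \<le> - abel_weight \<beta> \<epsilon> s"
    and "- abel_weight \<beta> \<epsilon> s \<le> \<beta> * (s - 2 * \<epsilon>) powr (- \<beta> - 1)"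
    using \<beta> by (simp_all add: mult_left_mono)
qed

lemma abel_weight_front:
  "0 < \<epsilon> \<Longrightarrow> s \<le> 2 * \<epsilon> \<Longrightarrow> abel_weight \<beta> \<epsilon> s = rl_kernel (1 - \<beta>) (s - \<epsilon>) / \<epsilon>"
  by (simp add: abel_weight_def rl_kernel_def)

lemma integrable_abel_weight:
  assumes \<beta>: "0 < \<beta>" "\<beta> < 1" and \<epsilon>: "0 < \<epsilon>"
  shows "integrable lborel (abel_weight \<beta> \<epsilon>)"
proof -
  define p where "p x = x powr - \<beta> * indicator {0..1 + \<epsilon>} x" for x :: real
  define q where "q x = x powr (- \<beta> - 1) * indicator {1..} x" for x :: real
  have [measurable]: "p \<in> borel_measurable borel" "q \<in> borel_measurable borel"
    unfolding p_def[abs_def] q_def[abs_def] by measurable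
  have p: "integrable lborel p"
    using nn_integral_powr_0[of "- \<beta>" "1 + \<epsilon>"] \<beta> \<epsilon>
    by (intro integrableI_nn_integral_finite) (auto simp: p_def ennreal_mult'' ennreal_indicator)
  have q: "integrable lborel q"
    using nn_integral_powr_tail[of "- \<beta> - 1" 1] \<beta> \<epsilon>
    by (intro integrableI_nn_integral_finite) (auto simp: q_def ennreal_mult'' ennreal_indicator)
  have i: "integrable lborel (\<lambda>s. p (s - \<epsilon>) / \<epsilon> + p (s - 2 * \<epsilon>) / \<epsilon> + \<beta> * q (s - 2 * \<epsilon>))"
    using lborel_integrable_real_affine[OF p, of 1 "- \<epsilon>"] lborel_integrable_real_affine[OF p, of 1 "- 2 * \<epsilon>"]
      lborel_integrable_real_affine[OF q, of 1 "- 2 * \<epsilon>"] by simp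
  have "\<bar>abel_weight \<beta> \<epsilon> s\<bar> \<le> p (s - \<epsilon>) / \<epsilon> + p (s - 2 * \<epsilon>) / \<epsilon> + \<beta> * q (s - 2 * \<epsilon>)" for s
  proof -
    have nn: "0 \<le> p x" "0 \<le> q x" for x by (auto simp: p_def q_def)
    then have nn': "0 \<le> p (s - \<epsilon>) / \<epsilon>" "0 \<le> p (s - 2 * \<epsilon>) / \<epsilon>" "0 \<le> \<beta> * q (s - 2 * \<epsilon>)"
      using \<beta> \<epsilon> by simp_all
    consider "s \<le> \<epsilon>" | "\<epsilon> < s" "s \<le> 2 * \<epsilon>" | "2 * \<epsilon> < s" "s \<le> 2 * \<epsilon> + 1" | "2 * \<epsilon> + 1 < s" by linarith
    then show ?thesis
    proof cases
      case 1
      then have "abel_weight \<beta> \<epsilon> s = 0" using \<epsilon> by (simp add: abel_weight_front rl_kernel_def)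
      then show ?thesis using nn' by linarith
    next
      case 2
      then have "\<bar>abel_weight \<beta> \<epsilon> s\<bar> = p (s - \<epsilon>) / \<epsilon>" using \<epsilon> by (simp add: abel_weight_front rl_kernel_def p_def)
      then show ?thesis using nn' by linarith
    next
      case 3
      have "0 \<le> \<beta> * s powr (- \<beta> - 1)" using \<beta> by simp
      then have "\<bar>abel_weight \<beta> \<epsilon> s\<bar> = - abel_weight \<beta> \<epsilon> s"
        using abel_weight_tail(1)[OF \<beta>(1) \<epsilon> 3(1)] by linarith
      also have "\<dots> \<le> (s - 2 * \<epsilon>) powr - \<beta> / \<epsilon>"
        using 3 \<epsilon> by (simp add: abel_weight_def rl_kernel_def diff_divide_distrib)
      also have "\<dots> = p (s - 2 * \<epsilon>) / \<epsilon>" using 3 \<epsilon> by (simp add: p_def)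
      finally show ?thesis using nn' by linarith
    next
      case 4
      then have s: "2 * \<epsilon> < s" by simp
      have "0 \<le> \<beta> * s powr (- \<beta> - 1)" using \<beta> by simp
      then have "\<bar>abel_weight \<beta> \<epsilon> s\<bar> = - abel_weight \<beta> \<epsilon> s"
        using abel_weight_tail(1)[OF \<beta>(1) \<epsilon> s] by linarith
      also have "\<dots> \<le> \<beta> * (s - 2 * \<epsilon>) powr (- \<beta> - 1)" by (rule abel_weight_tail(2)[OF \<beta>(1) \<epsilon> s])
      also have "\<dots> = \<beta> * q (s - 2 * \<epsilon>)" using 4 by (simp add: q_def)
      finally show ?thesis using nn' by linarith
    qed
  qed
  then show ?thesis
    by (intro Bochner_Integration.integrable_bound[OF i]) (auto intro!: AE_I2 order_trans[OF _ abs_ge_self])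
qed

lemma abel_weight_convolution:
  assumes \<beta>: "0 < \<beta>" "\<beta> < 1" and \<epsilon>: "0 < \<epsilon>"
  shows "(LINT s|lborel. abel_weight \<beta> \<epsilon> s * rl_kernel \<beta> (\<tau> - s))
    = Beta (1 - \<beta>) \<beta> / \<epsilon> * indicator {\<epsilon><..2 * \<epsilon>} \<tau>"
proof -
  note h = rl_kernel_convolution[OF \<beta>, THEN has_bochner_integral_integral_eq, of _ \<tau>]
    rl_kernel_convolution[OF \<beta>, THEN integrable.intros, of _ \<tau>]
  have "(LINT s|lborel. abel_weight \<beta> \<epsilon> s * rl_kernel \<beta> (\<tau> - s))
      = (LINT s|lborel. (rl_kernel (1 - \<beta>) (s - \<epsilon>) * rl_kernel \<beta> (\<tau> - s)
          - rl_kernel (1 - \<beta>) (s - 2 * \<epsilon>) * rl_kernel \<beta> (\<tau> - s)) / \<epsilon>)"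
    by (simp add: abel_weight_def algebra_simps)
  also have "\<dots> = ((LINT s|lborel. rl_kernel (1 - \<beta>) (s - \<epsilon>) * rl_kernel \<beta> (\<tau> - s))
      - (LINT s|lborel. rl_kernel (1 - \<beta>) (s - 2 * \<epsilon>) * rl_kernel \<beta> (\<tau> - s))) / \<epsilon>"
    using h(2) by simp
  also have "\<dots> = Beta (1 - \<beta>) \<beta> / \<epsilon> * indicator {\<epsilon><..2 * \<epsilon>} \<tau>"
    unfolding h(1) using \<epsilon> by (auto simp: indicator_def)
  finally show ?thesis .
qed

text \<open>
  Up to a constant factor, \<open>(-\<Delta>)\<^sup>\<beta>\<close> applied to the average of \<open>cube_flow \<tau>\<close> over \<open>\<epsilon> < \<tau> \<le> 2 * \<epsilon>\<close>.
\<close>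

definition mollified_frac_laplacian :: "real \<Rightarrow> real \<Rightarrow> 'a::euclidean_space \<Rightarrow> real" where
  "mollified_frac_laplacian \<beta> \<epsilon> x = (LINT s|lborel. abel_weight \<beta> \<epsilon> s * cube_flow s x)"

lemma mollified_frac_laplacian_measurable [measurable]: "mollified_frac_laplacian \<beta> \<epsilon> \<in> borel_measurable borel"
  unfolding mollified_frac_laplacian_def[abs_def] by measurable

lemma integrable_mollified_frac_laplacian:
  assumes "0 < \<beta>" "\<beta> < 1" "0 < \<epsilon>"
  shows "integrable lborel (mollified_frac_laplacian \<beta> \<epsilon> :: 'a::euclidean_space \<Rightarrow> real)"
  unfolding mollified_frac_laplacian_def[abs_def]
proof (rule superposition_integrable[where M = 1])
  show "(\<integral>\<^sup>+ x. ennreal \<bar>cube_flow s (x::'a)\<bar> \<partial>lborel) \<le> ennreal 1" if "abel_weight \<beta> \<epsilon> s \<noteq> 0" for s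
    using abel_weight_support[OF assms(3) that] assms(3) nn_integral_cube_flow[of s, where 'a = 'a] by simp
qed (use integrable_abel_weight[OF assms] in auto)

lemma continuous_mollified_frac_laplacian:
  assumes "0 < \<beta>" "\<beta> < 1" "0 < \<epsilon>"
  shows "continuous_on UNIV (mollified_frac_laplacian \<beta> \<epsilon> :: 'a::euclidean_space \<Rightarrow> real)"
proof (rule continuous_on_sequentiallyI)
  fix X :: "nat \<Rightarrow> 'a" and x
  assume X: "X \<longlonglongrightarrow> x"
  show "(\<lambda>n. mollified_frac_laplacian \<beta> \<epsilon> (X n)) \<longlonglongrightarrow> mollified_frac_laplacian \<beta> \<epsilon> x"
    unfolding mollified_frac_laplacian_def
  proof (rule integral_dominated_convergence)
    show "integrable lborel (\<lambda>s. \<bar>abel_weight \<beta> \<epsilon> s\<bar>)" using integrable_abel_weight[OF assms] by simp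
    have "(\<lambda>n. cube_flow s (X n)) \<longlonglongrightarrow> cube_flow s x" for s
      using continuous_on_tendsto_compose[OF continuous_cube_flow[of UNIV s] X] by simp
    then show "AE s in lborel. (\<lambda>n. abel_weight \<beta> \<epsilon> s * cube_flow s (X n)) \<longlonglongrightarrow> abel_weight \<beta> \<epsilon> s * cube_flow s x"
      by (intro AE_I2 tendsto_mult_left)
    have "\<bar>abel_weight \<beta> \<epsilon> s * cube_flow s y\<bar> \<le> \<bar>abel_weight \<beta> \<epsilon> s\<bar>" for s and y :: 'a
    proof (cases "abel_weight \<beta> \<epsilon> s = 0")
      case False
      then have "0 < s" using abel_weight_support[OF assms(3)] assms(3) by force
      then show ?thesis using cube_flow_le_1[of s y] by (simp add: abs_mult mult_left_le)
    qed simp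
    then show "AE s in lborel. norm (abel_weight \<beta> \<epsilon> s * cube_flow s (X n)) \<le> \<bar>abel_weight \<beta> \<epsilon> s\<bar>" for n
      by simp
  qed auto
qed

lemma nn_integral_abs_mult_bounded:
  fixes k g :: "'a::euclidean_space \<Rightarrow> real"
  assumes [measurable]: "k \<in> borel_measurable borel" and g: "\<And>x. \<bar>g x\<bar> \<le> B" and "0 \<le> M"
    and k: "(\<integral>\<^sup>+ x. ennreal \<bar>k x\<bar> \<partial>lborel) \<le> ennreal M"
  shows "(\<integral>\<^sup>+ x. ennreal \<bar>k x * g x\<bar> \<partial>lborel) \<le> ennreal (M * B)"
proof -
  have B: "0 \<le> B" using g[of 0] by simp
  have "(\<integral>\<^sup>+ x. ennreal \<bar>k x * g x\<bar> \<partial>lborel) \<le> (\<integral>\<^sup>+ x. ennreal \<bar>k x\<bar> * ennreal B \<partial>lborel)"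
    using g B by (intro nn_integral_mono) (auto simp: ennreal_mult'[symmetric] abs_mult intro!: ennreal_leI mult_left_mono)
  also have "\<dots> = (\<integral>\<^sup>+ x. ennreal \<bar>k x\<bar> \<partial>lborel) * ennreal B" by (intro nn_integral_multc) measurable
  also have "\<dots> \<le> ennreal M * ennreal B" by (intro mult_right_mono k) simp
  finally show ?thesis using \<open>0 \<le> M\<close> by (simp add: ennreal_mult')
qed

text \<open>
  Integration by parts at each fixed time \<open>\<tau>\<close>, between two exchanges of the integrals over \<open>\<tau>\<close> and \<open>x\<close>.
\<close>

lemma integral_cube_flow_average_derivative:
  fixes b :: "'a::euclidean_space" and m :: "real \<Rightarrow> real"
  assumes b: "b \<in> Basis" and m: "integrable lborel m" "\<And>\<tau>. m \<tau> \<noteq> 0 \<Longrightarrow> 0 < \<tau>"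
    and \<Phi>: "test_field \<Phi>"
  shows "integrable lborel (\<lambda>x. (LINT \<tau>|lborel. m \<tau> * cube_flow \<tau> x) * (frechet_derivative \<Phi> (at x) b \<bullet> b))"
    and "integrable lborel (\<lambda>x. (LINT \<tau>|lborel. m \<tau> * cube_flow_partial b \<tau> x) * (\<Phi> x \<bullet> b))"
    and "(LINT x|lborel. (LINT \<tau>|lborel. m \<tau> * cube_flow \<tau> x) * (frechet_derivative \<Phi> (at x) b \<bullet> b))
        = - (LINT x|lborel. (LINT \<tau>|lborel. m \<tau> * cube_flow_partial b \<tau> x) * (\<Phi> x \<bullet> b))"
proof -
  let ?f = "\<lambda>x. (LINT \<tau>|lborel. m \<tau> * cube_flow \<tau> x) * (frechet_derivative \<Phi> (at x) b \<bullet> b)"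
  let ?g = "\<lambda>x. (LINT \<tau>|lborel. m \<tau> * cube_flow_partial b \<tau> x) * (\<Phi> x \<bullet> b)"
  obtain B R where \<phi>:
    "\<And>x t. ((\<lambda>t. \<Phi> (x + t *\<^sub>R b) \<bullet> b) has_real_derivative
        frechet_derivative \<Phi> (at (x + t *\<^sub>R b)) b \<bullet> b) (at t)"
    "continuous_on UNIV (\<lambda>x. \<Phi> x \<bullet> b)"
    "continuous_on UNIV (\<lambda>x. frechet_derivative \<Phi> (at x) b \<bullet> b)"
    "\<And>x. \<bar>\<Phi> x \<bullet> b\<bar> \<le> B" "\<And>x. \<bar>frechet_derivative \<Phi> (at x) b \<bullet> b\<bar> \<le> B"
    "\<And>x. R \<le> norm x \<Longrightarrow> \<Phi> x \<bullet> b = 0"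
    "\<And>x. R \<le> norm x \<Longrightarrow> frechet_derivative \<Phi> (at x) b \<bullet> b = 0"
    by (rule test_field_component[OF \<Phi>, of b]) (rule that)
  have [measurable]: "(\<lambda>x. \<Phi> x \<bullet> b) \<in> borel_measurable borel"
      "(\<lambda>x. frechet_derivative \<Phi> (at x) b \<bullet> b) \<in> borel_measurable borel"
    using \<phi>(2,3) by (simp_all add: borel_measurable_continuous_onI)
  have B: "0 \<le> B" using \<phi>(4)[of 0] by simp
  have f_eq: "?f = (\<lambda>x. LINT \<tau>|lborel. m \<tau> * (cube_flow \<tau> x * (frechet_derivative \<Phi> (at x) b \<bullet> b)))"
   and g_eq: "?g = (\<lambda>x. LINT \<tau>|lborel. m \<tau> * (cube_flow_partial b \<tau> x * (\<Phi> x \<bullet> b)))"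
    by (simp_all add: mult.assoc[symmetric])
  have bf: "(\<integral>\<^sup>+ x. ennreal \<bar>cube_flow \<tau> x * (frechet_derivative \<Phi> (at x) b \<bullet> b)\<bar> \<partial>lborel) \<le> ennreal (1 * B)"
    if "m \<tau> \<noteq> 0" for \<tau>
    using nn_integral_cube_flow[OF m(2)[OF that], where 'a = 'a]
    by (intro nn_integral_abs_mult_bounded \<phi>) auto
  have bg: "(\<integral>\<^sup>+ x. ennreal \<bar>cube_flow_partial b \<tau> x * (\<Phi> x \<bullet> b)\<bar> \<partial>lborel) \<le> ennreal (2 * B)"
    if "m \<tau> \<noteq> 0" for \<tau>
    using nn_integral_abs_cube_flow_partial[OF m(2)[OF that] b]
    by (intro nn_integral_abs_mult_bounded \<phi>) auto
  show "integrable lborel ?f" unfolding f_eq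
    by (rule superposition_integrable[OF m(1) _ _ bf]) (use B in auto)
  show "integrable lborel ?g" unfolding g_eq
    by (rule superposition_integrable[OF m(1) _ _ bg]) (use B in auto)
  have "(LINT x|lborel. ?f x) = (LINT \<tau>|lborel. m \<tau> * (LINT x|lborel. cube_flow \<tau> x * (frechet_derivative \<Phi> (at x) b \<bullet> b)))"
    unfolding f_eq by (rule superposition_swap[OF m(1) _ _ bf]) (use B in auto)
  also have "\<dots> = (LINT \<tau>|lborel. - (m \<tau> * (LINT x|lborel. cube_flow_partial b \<tau> x * (\<Phi> x \<bullet> b))))"
  proof (rule Bochner_Integration.integral_cong[OF refl])
    fix \<tau>
    show "m \<tau> * (LINT x|lborel. cube_flow \<tau> x * (frechet_derivative \<Phi> (at x) b \<bullet> b))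
        = - (m \<tau> * (LINT x|lborel. cube_flow_partial b \<tau> x * (\<Phi> x \<bullet> b)))"
    proof (cases "m \<tau> = 0")
      case False
      note \<tau> = m(2)[OF False]
      have "(LINT x|lborel. cube_flow \<tau> x * (frechet_derivative \<Phi> (at x) b \<bullet> b))
          = - (LINT x|lborel. cube_flow_partial b \<tau> x * (\<Phi> x \<bullet> b))"
      proof (rule integration_by_parts_direction)
        show "\<bar>cube_flow \<tau> x\<bar> \<le> 1 + 1 / sqrt \<tau>" "\<bar>cube_flow_partial b \<tau> x\<bar> \<le> 1 + 1 / sqrt \<tau>" for x :: 'a
          using cube_flow_le_1[OF \<tau>, of x] abs_cube_flow_partial_le[OF \<tau>, of b x] \<tau>
            zero_le_divide_1_iff[of "sqrt \<tau>"] by (simp_all add: add_increasing add_increasing2)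
      qed (use \<phi> cube_flow_has_partial[OF b] in auto)
      then show ?thesis by simp
    qed simp
  qed
  also have "\<dots> = - (LINT \<tau>|lborel. m \<tau> * (LINT x|lborel. cube_flow_partial b \<tau> x * (\<Phi> x \<bullet> b)))"
    by simp
  also have "\<dots> = - (LINT x|lborel. ?g x)"
    unfolding g_eq by (subst superposition_swap[OF m(1) _ _ bg]) (use B in auto)
  finally show "(LINT x|lborel. ?f x) = - (LINT x|lborel. ?g x)" .
qed

text \<open>
  The Riesz potential is a constant multiple of the average of \<open>cube_flow \<tau>\<close>, whose gradient is the
  average of the gradients. The total mass of the averaging weight does not depend on \<open>\<epsilon>\<close>, nor does the
  bound on the \<open>L\<^sup>1\<close> norm of the gradients.
\<close>

lemma mollified_frac_laplacian_frac_gradient: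
  assumes \<beta>: "0 < \<beta>" "\<beta> < 1 / 2"
  obtains C where "\<And>\<epsilon>. 0 < \<epsilon> \<Longrightarrow> \<exists>g. frac_gradient_L1 (1 - 2 * \<beta>) (mollified_frac_laplacian \<beta> \<epsilon>) g \<and>
      (LINT x|lborel. norm (g (x :: 'a::euclidean_space))) \<le> C"
proof -
  have \<beta>1: "\<beta> < 1" using \<beta> by simp
  obtain c where c: "\<And>a \<epsilon> (x::'a). integrable lborel a \<Longrightarrow> 0 < \<epsilon> \<Longrightarrow> (\<And>s. a s \<noteq> 0 \<Longrightarrow> \<epsilon> \<le> s) \<Longrightarrow>
      riesz_potential (2 * \<beta>) (\<lambda>y. LINT s|lborel. a s * cube_flow s y) x
        = c * (LINT \<tau>|lborel. (LINT s|lborel. a s * rl_kernel \<beta> (\<tau> - s)) * cube_flow \<tau> x)"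
    using riesz_potential_superposition[OF \<beta>, where 'a = 'a] by blast
  define C where "C = \<bar>c * Beta (1 - \<beta>) \<beta>\<bar>"
  show thesis
  proof (rule that)
    fix \<epsilon> :: real assume \<epsilon>: "0 < \<epsilon>"
    define m where "m \<tau> = c * Beta (1 - \<beta>) \<beta> / \<epsilon> * indicator {\<epsilon><..2 * \<epsilon>} \<tau>" for \<tau> :: real
    have "integrable lborel m"
      unfolding m_def[abs_def] using \<epsilon> by (intro integrable_mult_right integrable_real_indicator) auto
    moreover have "0 < \<tau>" if "m \<tau> \<noteq> 0" for \<tau>
      using that \<epsilon> by (auto simp: m_def indicator_def split: if_splits)
    ultimately have m: "integrable lborel m" "\<And>\<tau>. m \<tau> \<noteq> 0 \<Longrightarrow> 0 < \<tau>" by auto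
    have "(LINT \<tau>|lborel. \<bar>m \<tau>\<bar>) = (LINT \<tau>|lborel. C / \<epsilon> * indicator {\<epsilon><..2 * \<epsilon>} \<tau>)"
      using \<epsilon> by (intro Bochner_Integration.integral_cong) (auto simp: m_def C_def abs_mult)
    also have "\<dots> = C" using \<epsilon> by simp
    finally have norm_m: "(LINT \<tau>|lborel. \<bar>m \<tau>\<bar>) = C" .
    have riesz: "riesz_potential (1 - (1 - 2 * \<beta>)) (mollified_frac_laplacian \<beta> \<epsilon>) x = (LINT \<tau>|lborel. m \<tau> * cube_flow \<tau> x)" for x :: 'a
    proof -
      have "riesz_potential (2 * \<beta>) (mollified_frac_laplacian \<beta> \<epsilon>) x
          = c * (LINT \<tau>|lborel. (LINT s|lborel. abel_weight \<beta> \<epsilon> s * rl_kernel \<beta> (\<tau> - s)) * cube_flow \<tau> x)"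
        unfolding mollified_frac_laplacian_def[abs_def]
        using integrable_abel_weight[OF \<beta>(1) \<beta>1 \<epsilon>] \<epsilon> abel_weight_support[OF \<epsilon>] by (rule c)
      also have "\<dots> = (LINT \<tau>|lborel. m \<tau> * cube_flow \<tau> x)"
        by (subst Bochner_Integration.integral_mult_right_zero[symmetric])
           (simp add: abel_weight_convolution[OF \<beta>(1) \<beta>1 \<epsilon>] m_def mult_ac)
      finally show ?thesis by simp
    qed
    define V where "V b x = (LINT \<tau>|lborel. m \<tau> * cube_flow_partial b \<tau> x)" for b x :: 'a
    define g where "g x = (\<Sum>b\<in>Basis. V b x *\<^sub>R b)" for x
    have bd: "(\<integral>\<^sup>+ x. ennreal \<bar>cube_flow_partial b \<tau> x\<bar> \<partial>lborel) \<le> ennreal 2"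
      if "b \<in> Basis" "m \<tau> \<noteq> 0" for \<tau> and b :: 'a
      using nn_integral_abs_cube_flow_partial[OF m(2)[OF that(2)] that(1)] by simp
    have V: "integrable lborel (V b)" "(LINT x|lborel. \<bar>V b x\<bar>) \<le> 2 * C" if "b \<in> Basis" for b
    proof -
      show "integrable lborel (V b)" unfolding V_def[abs_def]
        by (rule superposition_integrable[OF m(1) _ _ bd[OF that]]) auto
      show "(LINT x|lborel. \<bar>V b x\<bar>) \<le> 2 * C" unfolding V_def norm_m[symmetric]
        by (rule superposition_norm[OF m(1) _ _ bd[OF that]]) auto
    qed
    have g: "integrable lborel g" unfolding g_def[abs_def] using V by auto
    have "(LINT x|lborel. norm (g x)) \<le> (LINT x|lborel. (\<Sum>b\<in>Basis. \<bar>V b x\<bar>))"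
      using g V unfolding g_def by (intro integral_mono) (auto intro!: sum_norm_le)
    also have "\<dots> = (\<Sum>b\<in>Basis. LINT x|lborel. \<bar>V b x\<bar>)" using V by (intro Bochner_Integration.integral_sum) auto
    also have "\<dots> \<le> (\<Sum>b\<in>(Basis::'a set). 2 * C)" using V by (intro sum_mono) auto
    finally have norm_g: "(LINT x|lborel. norm (g x)) \<le> 2 * C * DIM('a)" by (simp add: mult_ac)
    have "frac_gradient (1 - 2 * \<beta>) (mollified_frac_laplacian \<beta> \<epsilon>) \<Phi> = (LINT x|lborel. g x \<bullet> \<Phi> x)"
      if \<Phi>: "test_field \<Phi>" for \<Phi>
    proof -
      note ibp = integral_cube_flow_average_derivative[OF _ m \<Phi>]
      have "frac_gradient (1 - 2 * \<beta>) (mollified_frac_laplacian \<beta> \<epsilon>) \<Phi>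
          = - (LINT x|lborel. (\<Sum>b\<in>Basis. (LINT \<tau>|lborel. m \<tau> * cube_flow \<tau> x) * (frechet_derivative \<Phi> (at x) b \<bullet> b)))"
        unfolding frac_gradient_def riesz divergence_def by (simp add: sum_distrib_left)
      also have "\<dots> = - (\<Sum>b\<in>Basis. LINT x|lborel. (LINT \<tau>|lborel. m \<tau> * cube_flow \<tau> x) * (frechet_derivative \<Phi> (at x) b \<bullet> b))"
        using ibp(1) by (subst Bochner_Integration.integral_sum) auto
      also have "\<dots> = (\<Sum>b\<in>Basis. LINT x|lborel. V b x * (\<Phi> x \<bullet> b))"
        using ibp(3) by (simp add: sum_negf V_def)
      also have "\<dots> = (LINT x|lborel. (\<Sum>b\<in>Basis. V b x * (\<Phi> x \<bullet> b)))"
        using ibp(2) by (subst Bochner_Integration.integral_sum) (auto simp: V_def)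
      also have "\<dots> = (LINT x|lborel. g x \<bullet> \<Phi> x)"
        by (simp add: g_def inner_sum_left inner_commute[of "\<Phi> _"])
      finally show ?thesis .
    qed
    then show "\<exists>g. frac_gradient_L1 (1 - 2 * \<beta>) (mollified_frac_laplacian \<beta> \<epsilon>) g \<and> (LINT x|lborel. norm (g (x::'a))) \<le> 2 * C * DIM('a)"
      using g norm_g unfolding frac_gradient_L1_def by blast
  qed
qed

section \<open>Blow-up at a face of the cube\<close>

text \<open>
  On points within distance \<open>2 * sqrt s\<close> of \<open>t\<close> the heat kernel is at least of order \<open>1 / sqrt s\<close>, so a
  subinterval of \<open>[0, 1]\<close> of length \<open>sqrt s / 4\<close> among them contributes a constant independent of \<open>s\<close>.
\<close>

lemma slab_lower_bound:
  assumes s: "0 < s" and c: "{c..c + sqrt s / 4} \<subseteq> {0..1}"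
    and t: "\<And>y. c \<le> y \<Longrightarrow> y \<le> c + sqrt s / 4 \<Longrightarrow> \<bar>t - y\<bar> \<le> 2 * sqrt s"
  shows "exp (-1) / (8 * sqrt pi) \<le> slab s t"
proof -
  have "sqrt s / 4 * (exp (-1) / sqrt (4 * pi * s)) \<le> slab s t"
  proof (rule slab_ge[OF _ _ c])
    fix y assume "c \<le> y" "y \<le> c + sqrt s / 4"
    then have "\<bar>t - y\<bar>\<^sup>2 \<le> (2 * sqrt s)\<^sup>2" by (intro power_mono t) auto
    then have "(t - y)\<^sup>2 / (4 * s) \<le> 1" using s by (simp add: power_mult_distrib)
    then have "exp (-1) \<le> exp (- (t - y)\<^sup>2 / (4 * s))" by simp
    then show "exp (-1) / sqrt (4 * pi * s) \<le> heat s (t - y)"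
      using s by (simp add: heat_def divide_right_mono)
  qed (use s in auto)
  moreover have "sqrt s / 4 * (exp (-1) / sqrt (4 * pi * s)) = exp (-1) / (8 * sqrt pi)"
    using s by (simp add: real_sqrt_mult)
  ultimately show ?thesis by simp
qed

text \<open>
  The unit cube shifted by one in the direction \<open>e\<close>; it touches the unit cube in the face \<open>x \<bullet> e = 1\<close>.
\<close>

definition wall_region :: "'a \<Rightarrow> 'a::euclidean_space set" where
  "wall_region e = {x. 1 < x \<bullet> e \<and> x \<bullet> e < 2 \<and> (\<forall>b\<in>Basis - {e}. 0 < x \<bullet> b \<and> x \<bullet> b < 1)}"

text \<open>
  At distance \<open>\<delta>\<close> from the face, times of order \<open>\<delta>\<^sup>2\<close> suffice for the heat to arrive; in the other
  directions the point lies inside the cube.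
\<close>

lemma cube_flow_lower_bound:
  fixes e :: "'a::euclidean_space"
  assumes x: "x \<in> wall_region e" and s: "(x \<bullet> e - 1)\<^sup>2 \<le> s" "s \<le> 2 * (x \<bullet> e - 1)\<^sup>2"
  shows "(exp (-1) / (8 * sqrt pi)) ^ DIM('a) \<le> cube_flow s x"
proof -
  define \<delta> where "\<delta> = x \<bullet> e - 1"
  have \<delta>: "0 < \<delta>" "\<delta> < 1" using x by (auto simp: \<delta>_def wall_region_def)
  have s': "\<delta>\<^sup>2 \<le> s" "s \<le> 2 * \<delta>\<^sup>2" using s by (simp_all add: \<delta>_def)
  have "0 < \<delta>\<^sup>2" "\<delta>\<^sup>2 < 1" using \<delta> by (simp_all add: power_less_one_iff)
  then have s0: "0 < s" "s < 4" using s' by linarith+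
  then have sq: "sqrt s < 2" using real_sqrt_less_mono[of s 4] by simp
  have \<delta>s: "\<delta> \<le> sqrt s" using s'(1) \<delta> by (simp add: real_le_rsqrt)
  have sp: "0 < sqrt s" using s0 by simp
  have "exp (-1) / (8 * sqrt pi) \<le> slab s (x \<bullet> b)" if b: "b \<in> Basis" for b
  proof (cases "b = e")
    case True
    show ?thesis
    proof (rule slab_lower_bound[where c = "1 - sqrt s / 4", OF s0(1)])
      fix y assume "1 - sqrt s / 4 \<le> y" "y \<le> 1 - sqrt s / 4 + sqrt s / 4"
      then show "\<bar>x \<bullet> b - y\<bar> \<le> 2 * sqrt s" using True \<delta> \<delta>s by (simp add: \<delta>_def)
    qed (use sq sp in auto)
  next
    case False
    then have xb: "0 < x \<bullet> b" "x \<bullet> b < 1" using x b by (auto simp: wall_region_def)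
    show ?thesis
    proof (cases "x \<bullet> b \<le> 1 / 2")
      case True
      show ?thesis
        by (rule slab_lower_bound[where c = "x \<bullet> b", OF s0(1)]) (use True xb sq sp in auto)
    next
      case False
      show ?thesis
        by (rule slab_lower_bound[where c = "x \<bullet> b - sqrt s / 4", OF s0(1)]) (use False xb sq sp in auto)
    qed
  qed
  then have "(\<Prod>b\<in>(Basis::'a set). exp (-1) / (8 * sqrt pi)) \<le> cube_flow s x"
    unfolding cube_flow_def by (intro prod_mono) auto
  then show ?thesis by simp
qed

text \<open>
  Up to times of order \<open>\<epsilon>\<close> hardly any heat has crossed the distance \<open>\<delta>\<close> if \<open>\<epsilon>\<close> is small against \<open>\<delta>\<^sup>2\<close>. The
  estimate \<open>exp (- z) \<le> 1 / z\<close> for the Gaussian gives the power \<open>\<epsilon>\<^bsup>1/2\<^esup>\<close>, which outweighs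
  \<open>\<epsilon>\<^bsup>-\<beta>\<^esup>\<close>.
\<close>

lemma cube_flow_upper_bound:
  fixes e :: "'a::euclidean_space"
  assumes e: "e \<in> Basis" and x: "x \<in> wall_region e" and s: "0 < s" "s \<le> 2 * \<epsilon>"
  shows "cube_flow s x \<le> 8 * sqrt \<epsilon> / (x \<bullet> e - 1)\<^sup>2"
proof -
  define \<delta> where "\<delta> = x \<bullet> e - 1"
  have \<delta>: "0 < \<delta>" using x by (simp add: \<delta>_def wall_region_def)
  have "cube_flow s x \<le> slab s (x \<bullet> e)" by (rule cube_flow_le_slab[OF s(1) e])
  also have "\<dots> \<le> heat s \<delta>"
    by (intro slab_le heat_antimono) (use \<delta> in \<open>auto simp: \<delta>_def\<close>)
  also have "\<dots> \<le> (4 * s / \<delta>\<^sup>2) / sqrt s"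
  proof -
    have "\<delta>\<^sup>2 / (4 * s) \<le> exp (\<delta>\<^sup>2 / (4 * s))" using exp_ge_add_one_self[of "\<delta>\<^sup>2 / (4 * s)"] by linarith
    then have "inverse (exp (\<delta>\<^sup>2 / (4 * s))) \<le> inverse (\<delta>\<^sup>2 / (4 * s))"
      using s \<delta> by (intro le_imp_inverse_le) auto
    then have "exp (- \<delta>\<^sup>2 / (4 * s)) \<le> 4 * s / \<delta>\<^sup>2" by (simp add: exp_minus)
    moreover have "sqrt s \<le> sqrt (4 * pi * s)"
      using s pi_ge_two mult_right_mono[of 1 "4 * pi" s] by simp
    ultimately have "exp (- \<delta>\<^sup>2 / (4 * s)) / sqrt (4 * pi * s) \<le> (4 * s / \<delta>\<^sup>2) / sqrt s"
      using s by (intro frac_le) auto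
    then show ?thesis using s by (simp add: heat_def)
  qed
  also have "\<dots> = 4 * (s / sqrt s) / \<delta>\<^sup>2" by simp
  also have "\<dots> = 4 * sqrt s / \<delta>\<^sup>2" using s by (simp only: real_div_sqrt)
  also have "\<dots> \<le> 8 * sqrt \<epsilon> / \<delta>\<^sup>2"
  proof -
    have "sqrt s \<le> sqrt (4 * \<epsilon>)" using s by (intro real_sqrt_le_mono) linarith
    then show ?thesis by (intro divide_right_mono) (simp_all add: real_sqrt_mult)
  qed
  finally show ?thesis by (simp add: \<delta>_def)
qed

lemma has_bochner_integral_powr_shift:
  fixes p l c :: real
  assumes "-1 < p" "0 < l"
  shows "has_bochner_integral lborel (\<lambda>s. (s - c) powr p * indicator {c..c + l} s) (l powr (p + 1) / (p + 1))"
proof (rule has_bochner_integral_nn_integral)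
  have "(\<integral>\<^sup>+ s. ennreal ((s - c) powr p * indicator {c..c + l} s) \<partial>lborel)
      = (\<integral>\<^sup>+ s. ennreal (s powr p) * indicator {0..l} s \<partial>lborel)"
    by (subst nn_integral_real_affine[where c = 1 and t = c])
       (auto intro!: nn_integral_cong simp: indicator_def)
  then show "(\<integral>\<^sup>+ s. ennreal ((s - c) powr p * indicator {c..c + l} s) \<partial>lborel) = ennreal (l powr (p + 1) / (p + 1))"
    using assms by (simp add: nn_integral_powr_0)
qed (use assms in auto)

text \<open>
  The negative tail of the weight, near the time \<open>\<delta>\<^sup>2\<close>, produces the main term. The positive part of the
  weight has total mass of order \<open>\<epsilon>\<^bsup>-\<beta>\<^esup>\<close> and lives on times up to \<open>2 * \<epsilon>\<close>, when the flow at the point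
  \<open>x\<close> is at most of order \<open>sqrt \<epsilon>\<close>; it produces the error term, which vanishes in the limit if \<open>\<beta> < 1 / 2\<close>.
\<close>

lemma mollified_frac_laplacian_lower_bound:
  fixes e :: "'a::euclidean_space"
  assumes \<beta>: "0 < \<beta>" "\<beta> < 1" and e: "e \<in> Basis" and x: "x \<in> wall_region e"
    and \<epsilon>: "0 < \<epsilon>" "2 * \<epsilon> < (x \<bullet> e - 1)\<^sup>2"
  shows "\<beta> * (exp (-1) / (8 * sqrt pi)) ^ DIM('a) * 2 powr (- \<beta> - 1) * (x \<bullet> e - 1) powr (- 2 * \<beta>)
      - 8 / ((x \<bullet> e - 1)\<^sup>2 * (1 - \<beta>)) * \<epsilon> powr (1 / 2 - \<beta>) \<le> - mollified_frac_laplacian \<beta> \<epsilon> x"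
proof -
  define \<delta> where "\<delta> = x \<bullet> e - 1"
  have \<delta>: "0 < \<delta>" "2 * \<epsilon> < \<delta>\<^sup>2" using x \<epsilon> by (auto simp: \<delta>_def wall_region_def)
  \<comment> \<open>a lower bound for the flow at times between \<open>\<delta>\<^sup>2\<close> and \<open>2 * \<delta>\<^sup>2\<close>\<close>
  define \<kappa> where "\<kappa> = (exp (-1) / (8 * sqrt pi)) ^ DIM('a)"
  have \<kappa>: "0 < \<kappa>" by (simp add: \<kappa>_def)
  define P where "P = \<beta> * (2 * \<delta>\<^sup>2) powr (- \<beta> - 1) * \<kappa>"
  define Q where "Q = 8 * sqrt \<epsilon> / \<delta>\<^sup>2 / \<epsilon>"
  \<comment> \<open>a minorant of the integrand whose integral is explicit\<close>
  define h where "h s = P * indicator {\<delta>\<^sup>2..2 * \<delta>\<^sup>2} s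
      - Q * ((s - \<epsilon>) powr - \<beta> * indicator {\<epsilon>..\<epsilon> + \<epsilon>} s)" for s
  have PQ: "0 \<le> P" "0 \<le> Q" using \<beta> \<kappa> \<epsilon> by (simp_all add: P_def Q_def)
  have "has_bochner_integral lborel (\<lambda>s. P * indicator {\<delta>\<^sup>2..2 * \<delta>\<^sup>2} s) (P * \<delta>\<^sup>2)"
    by (intro has_bochner_integral_mult_right has_bochner_integral_real_indicator[THEN has_bochner_integral_cong[THEN iffD1, rotated -1]]) auto
  moreover have "has_bochner_integral lborel (\<lambda>s. Q * ((s - \<epsilon>) powr - \<beta> * indicator {\<epsilon>..\<epsilon> + \<epsilon>} s))
      (Q * (\<epsilon> powr (- \<beta> + 1) / (- \<beta> + 1)))"
    using \<beta> \<epsilon> by (intro has_bochner_integral_mult_right has_bochner_integral_powr_shift) auto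
  ultimately have h: "has_bochner_integral lborel h (P * \<delta>\<^sup>2 - Q * (\<epsilon> powr (- \<beta> + 1) / (- \<beta> + 1)))"
    unfolding h_def[abs_def] by (rule has_bochner_integral_diff)
  have le: "h s \<le> - (abel_weight \<beta> \<epsilon> s * cube_flow s x)" for s
  proof -
    consider "s \<le> \<epsilon>" | "\<epsilon> < s" "s \<le> 2 * \<epsilon>" | "2 * \<epsilon> < s" by linarith
    then show ?thesis
    proof cases
      case 1
      then have "abel_weight \<beta> \<epsilon> s = 0" using \<epsilon> by (simp add: abel_weight_front rl_kernel_def)
      moreover have "indicator {\<delta>\<^sup>2..2 * \<delta>\<^sup>2} s = (0::real)" using 1 \<delta> \<epsilon> by (simp add: indicator_def)
      ultimately show ?thesis using PQ by (simp add: h_def)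
    next
      case 2
      have "abel_weight \<beta> \<epsilon> s * cube_flow s x \<le> (s - \<epsilon>) powr - \<beta> / \<epsilon> * (8 * sqrt \<epsilon> / \<delta>\<^sup>2)"
        using 2 \<epsilon> cube_flow_upper_bound[OF e x, of s \<epsilon>]
        by (simp only: \<delta>_def) (intro mult_mono, auto simp: abel_weight_front rl_kernel_def)
      also have "\<dots> = Q * (s - \<epsilon>) powr - \<beta>" by (simp add: Q_def mult_ac)
      finally show ?thesis using 2 \<delta> by (simp add: h_def)
    next
      case 3
      have "P * indicator {\<delta>\<^sup>2..2 * \<delta>\<^sup>2} s \<le> (\<beta> * s powr (- \<beta> - 1)) * cube_flow s x"
      proof (cases "s \<in> {\<delta>\<^sup>2..2 * \<delta>\<^sup>2}")
        case True
        have "(2 * \<delta>\<^sup>2) powr (- \<beta> - 1) \<le> s powr (- \<beta> - 1)"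
          using True 3 \<epsilon> \<beta> by (intro powr_mono2') auto
        moreover have "\<kappa> \<le> cube_flow s x"
          unfolding \<kappa>_def using True by (intro cube_flow_lower_bound[OF x]) (auto simp: \<delta>_def)
        ultimately have "\<beta> * (2 * \<delta>\<^sup>2) powr (- \<beta> - 1) * \<kappa> \<le> (\<beta> * s powr (- \<beta> - 1)) * cube_flow s x"
          using \<beta> \<kappa> by (intro mult_mono) auto
        then show ?thesis using True by (simp add: P_def)
      qed (use \<beta> in simp)
      also have "\<dots> \<le> - abel_weight \<beta> \<epsilon> s * cube_flow s x"
        using abel_weight_tail(1)[OF \<beta>(1) \<epsilon>(1) 3] by (intro mult_right_mono) auto
      finally show ?thesis using 3 by (simp add: h_def)
    qed
  qed
  have int: "integrable lborel (\<lambda>s. abel_weight \<beta> \<epsilon> s * cube_flow s x)"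
  proof (rule Bochner_Integration.integrable_bound[OF integrable_abel_weight[OF \<beta> \<epsilon>(1)]])
    have "\<bar>abel_weight \<beta> \<epsilon> s\<bar> * \<bar>cube_flow s x\<bar> \<le> \<bar>abel_weight \<beta> \<epsilon> s\<bar>" for s
      using cube_flow_le_1[of s x] abel_weight_support[OF \<epsilon>(1), of \<beta> s] \<epsilon>(1)
      by (cases "abel_weight \<beta> \<epsilon> s = 0") (auto intro: mult_left_le)
    then show "AE s in lborel. norm (abel_weight \<beta> \<epsilon> s * cube_flow s x) \<le> norm (abel_weight \<beta> \<epsilon> s)"
      by (simp add: abs_mult)
  qed measurable
  have "P * \<delta>\<^sup>2 - Q * (\<epsilon> powr (- \<beta> + 1) / (- \<beta> + 1)) = (LINT s|lborel. h s)"
    using h by (simp add: has_bochner_integral_iff)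
  also have "\<dots> \<le> (LINT s|lborel. - (abel_weight \<beta> \<epsilon> s * cube_flow s x))"
    using h int le by (intro integral_mono) (auto simp: has_bochner_integral_iff)
  also have "\<dots> = - mollified_frac_laplacian \<beta> \<epsilon> x" by (simp add: mollified_frac_laplacian_def)
  finally have "P * \<delta>\<^sup>2 - Q * (\<epsilon> powr (- \<beta> + 1) / (- \<beta> + 1)) \<le> - mollified_frac_laplacian \<beta> \<epsilon> x" .
  moreover have "P * \<delta>\<^sup>2 = \<beta> * \<kappa> * 2 powr (- \<beta> - 1) * \<delta> powr (- 2 * \<beta>)"
  proof -
    have "(2 * \<delta>\<^sup>2) powr (- \<beta> - 1) * \<delta>\<^sup>2 = 2 powr (- \<beta> - 1) * (\<delta> powr (2 * (- \<beta> - 1)) * \<delta> powr 2)"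
      using \<delta> by (simp add: powr_mult powr_powr powr_numeral[symmetric] del: powr_numeral)
    also have "\<dots> = 2 powr (- \<beta> - 1) * \<delta> powr (- 2 * \<beta>)"
      by (simp only: powr_add[symmetric]) simp
    finally show ?thesis by (simp add: P_def mult_ac)
  qed
  moreover have "Q * (\<epsilon> powr (- \<beta> + 1) / (- \<beta> + 1)) = 8 / (\<delta>\<^sup>2 * (1 - \<beta>)) * \<epsilon> powr (1 / 2 - \<beta>)"
  proof -
    have "sqrt \<epsilon> / \<epsilon> * \<epsilon> powr (- \<beta> + 1) = \<epsilon> powr (1 / 2 - \<beta>)"
    proof -
      have "sqrt \<epsilon> / \<epsilon> = \<epsilon> powr (1 / 2 - 1)" using \<epsilon> by (simp only: powr_diff powr_half_sqrt) simp
      then show ?thesis by (simp only: powr_add[symmetric]) simp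
    qed
    moreover have "Q * (\<epsilon> powr (- \<beta> + 1) / (- \<beta> + 1))
        = 8 / (\<delta>\<^sup>2 * (1 - \<beta>)) * (sqrt \<epsilon> / \<epsilon> * \<epsilon> powr (- \<beta> + 1))"
      by (simp add: Q_def mult_ac)
    ultimately show ?thesis by simp
  qed
  ultimately show ?thesis by (simp add: \<kappa>_def \<delta>_def)
qed

lemma mollified_frac_laplacian_blowup:
  assumes \<beta>: "0 < \<beta>" "\<beta> < 1 / 2"
  obtains c where "0 < c" "\<And>(e :: 'a::euclidean_space) x. e \<in> Basis \<Longrightarrow> x \<in> wall_region e \<Longrightarrow>
      \<forall>\<^sub>F n in sequentially. c * (x \<bullet> e - 1) powr (- 2 * \<beta>) \<le> \<bar>mollified_frac_laplacian \<beta> (1 / real (Suc n)) x\<bar>"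
proof -
  define c where "c = \<beta> * (exp (-1) / (8 * sqrt pi)) ^ DIM('a) * 2 powr (- \<beta> - 1)"
  have c: "0 < c" using \<beta> by (simp add: c_def)
  show thesis
  proof (rule that)
    show "0 < c / 2" using c by simp
    fix e x :: 'a assume e: "e \<in> Basis" and x: "x \<in> wall_region e"
    define \<delta> where "\<delta> = x \<bullet> e - 1"
    have \<delta>: "0 < \<delta>" using x by (simp add: \<delta>_def wall_region_def)
    have lim: "(\<lambda>n. 1 / real (Suc n)) \<longlonglongrightarrow> 0" using LIMSEQ_inverse_real_of_nat by (simp add: inverse_eq_divide)
    have "(\<lambda>n. 8 / (\<delta>\<^sup>2 * (1 - \<beta>)) * (1 / real (Suc n)) powr (1 / 2 - \<beta>)) \<longlonglongrightarrow> 8 / (\<delta>\<^sup>2 * (1 - \<beta>)) * 0"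
      using \<beta> by (intro tendsto_mult_left tendsto_zero_powrI[OF lim, where b = "1 / 2 - \<beta>"]) auto
    then have "(\<lambda>n. 8 / (\<delta>\<^sup>2 * (1 - \<beta>)) * (1 / real (Suc n)) powr (1 / 2 - \<beta>)) \<longlonglongrightarrow> 0" by simp
    then have "\<forall>\<^sub>F n in sequentially. 8 / (\<delta>\<^sup>2 * (1 - \<beta>)) * (1 / real (Suc n)) powr (1 / 2 - \<beta>) < c / 2 * \<delta> powr (- 2 * \<beta>)"
      using c \<delta> by (intro order_tendstoD) auto
    moreover have "\<forall>\<^sub>F n in sequentially. 1 / real (Suc n) < \<delta>\<^sup>2 / 2"
      using lim \<delta> by (intro order_tendstoD) auto
    ultimately show "\<forall>\<^sub>F n in sequentially. c / 2 * (x \<bullet> e - 1) powr (- 2 * \<beta>) \<le> \<bar>mollified_frac_laplacian \<beta> (1 / real (Suc n)) x\<bar>"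
    proof eventually_elim
      case (elim n)
      have "c * \<delta> powr (- 2 * \<beta>) - 8 / (\<delta>\<^sup>2 * (1 - \<beta>)) * (1 / real (Suc n)) powr (1 / 2 - \<beta>)
          \<le> - mollified_frac_laplacian \<beta> (1 / real (Suc n)) x"
        unfolding c_def \<delta>_def using \<beta> elim(2) by (intro mollified_frac_laplacian_lower_bound e x) (auto simp: \<delta>_def)
      then have "c / 2 * \<delta> powr (- 2 * \<beta>) \<le> - mollified_frac_laplacian \<beta> (1 / real (Suc n)) x"
        using elim(1) by simp
      then show ?case unfolding \<delta>_def by linarith
    qed
  qed
qed

section \<open>A measure of critical growth at the face\<close>

text \<open>
  The coordinate factors of the density \<open>(x \<bullet> e - 1)\<^sup>-\<^sup>\<alpha>\<close> restricted to \<open>wall_region e\<close>.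
\<close>

definition wall_factor :: "real \<Rightarrow> 'a \<Rightarrow> 'a \<Rightarrow> real \<Rightarrow> real" where
  "wall_factor \<alpha> e b t =
     (if b = e then (t - 1) powr - \<alpha> * indicator {1<..<2} t else indicator {0<..<1} t)"

definition wall_weight :: "real \<Rightarrow> 'a \<Rightarrow> 'a::euclidean_space \<Rightarrow> real" where
  "wall_weight \<alpha> e x = (\<Prod>b\<in>Basis. wall_factor \<alpha> e b (x \<bullet> b))"

lemma wall_factor_measurable [measurable]: "wall_factor \<alpha> e b \<in> borel_measurable borel"
  unfolding wall_factor_def[abs_def] by measurable

lemma wall_factor_nonneg [simp]: "0 \<le> wall_factor \<alpha> e b t"
  by (simp add: wall_factor_def)

lemma wall_weight_measurable [measurable]: "wall_weight \<alpha> e \<in> borel_measurable borel"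
  unfolding wall_weight_def[abs_def] by measurable

lemma wall_weight_nonneg [simp]: "0 \<le> wall_weight \<alpha> e x"
  by (simp add: wall_weight_def prod_nonneg)

lemma wall_weight_support:
  assumes "e \<in> Basis" "wall_weight \<alpha> e x \<noteq> 0" shows "x \<in> wall_region e"
proof -
  have nz: "wall_factor \<alpha> e b (x \<bullet> b) \<noteq> 0" if "b \<in> Basis" for b
    using assms(2) that by (simp add: wall_weight_def)
  have "x \<bullet> e \<in> {1<..<2}" using nz[OF assms(1)] by (auto simp: wall_factor_def indicator_def split: if_splits)
  moreover have "x \<bullet> b \<in> {0<..<1}" if "b \<in> Basis - {e}" for b
    using nz[of b] that by (auto simp: wall_factor_def indicator_def split: if_splits)
  ultimately show ?thesis by (simp add: wall_region_def)
qed

text \<open>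
  Within distance \<open>r\<close> of the singularity the primitive is used, elsewhere the factor is at most
  \<open>r powr - \<alpha>\<close>; this treats all positions of the interval at once.
\<close>

lemma nn_integral_wall_factor:
  assumes \<alpha>: "0 < \<alpha>" "\<alpha> < 1" and r: "0 < r"
  shows "(\<integral>\<^sup>+ t. ennreal (wall_factor \<alpha> e e t) * indicator {a - r<..<a + r} t \<partial>lborel)
    \<le> ennreal (3 / (1 - \<alpha>) * r powr (1 - \<alpha>))"
proof -
  have hb: "has_bochner_integral lborel (\<lambda>t. (t - 1) powr - \<alpha> * indicator {1..1 + r} t) (r powr (- \<alpha> + 1) / (- \<alpha> + 1))"
    using \<alpha> r by (intro has_bochner_integral_powr_shift) auto
  have "(\<integral>\<^sup>+ t. ennreal (wall_factor \<alpha> e e t) * indicator {a - r<..<a + r} t \<partial>lborel)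
      \<le> (\<integral>\<^sup>+ t. ennreal ((t - 1) powr - \<alpha> * indicator {1..1 + r} t) + ennreal (r powr - \<alpha>) * indicator {a - r<..<a + r} t \<partial>lborel)"
  proof (rule nn_integral_mono)
    fix t
    have "wall_factor \<alpha> e e t \<le> (t - 1) powr - \<alpha> * indicator {1..1 + r} t + r powr - \<alpha>"
    proof (cases "t \<in> {1..1 + r}")
      case False
      then have "wall_factor \<alpha> e e t \<le> r powr - \<alpha>"
        using \<alpha> r by (auto simp: wall_factor_def indicator_def intro!: powr_mono2')
      then show ?thesis using False by simp
    qed (auto simp: wall_factor_def indicator_def)
    then have "ennreal (wall_factor \<alpha> e e t) \<le> ennreal ((t - 1) powr - \<alpha> * indicator {1..1 + r} t) + ennreal (r powr - \<alpha>)"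
      by (subst ennreal_plus[symmetric]) (simp_all add: ennreal_leI del: ennreal_plus)
    then show "ennreal (wall_factor \<alpha> e e t) * indicator {a - r<..<a + r} t
        \<le> ennreal ((t - 1) powr - \<alpha> * indicator {1..1 + r} t) + ennreal (r powr - \<alpha>) * indicator {a - r<..<a + r} t"
      by (cases "t \<in> {a - r<..<a + r}") simp_all
  qed
  also have "\<dots> = ennreal (r powr (1 - \<alpha>) / (1 - \<alpha>)) + ennreal (r powr - \<alpha>) * ennreal (2 * r)"
  proof -
    have "(\<integral>\<^sup>+ t. ennreal ((t - 1) powr - \<alpha> * indicator {1..1 + r} t) \<partial>lborel) = ennreal (r powr (1 - \<alpha>) / (1 - \<alpha>))"
      using hb by (subst nn_integral_eq_integral) (auto simp: has_bochner_integral_iff)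
    moreover have "(\<integral>\<^sup>+ t. ennreal (r powr - \<alpha>) * indicator {a - r<..<a + r} t \<partial>lborel) = ennreal (r powr - \<alpha>) * ennreal (2 * r)"
      using r by (subst nn_integral_cmult_indicator) auto
    ultimately show ?thesis by (subst nn_integral_add) simp_all
  qed
  also have "\<dots> = ennreal (r powr (1 - \<alpha>) / (1 - \<alpha>) + 2 * r powr (1 - \<alpha>))"
  proof -
    have "r powr - \<alpha> * (2 * r) = 2 * r powr (1 - \<alpha>)" using r powr_mult_base[of r "- \<alpha>"] by (simp add: mult_ac)
    then show ?thesis using \<alpha> r by (simp add: ennreal_mult[symmetric] ennreal_plus[symmetric] del: ennreal_plus)
  qed
  also have "\<dots> \<le> ennreal (3 / (1 - \<alpha>) * r powr (1 - \<alpha>))"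
  proof (rule ennreal_leI)
    have "2 * r powr (1 - \<alpha>) \<le> 2 * (r powr (1 - \<alpha>) / (1 - \<alpha>))"
      using \<alpha> r by (intro mult_left_mono) (auto simp: le_divide_eq mult_left_le)
    then show "r powr (1 - \<alpha>) / (1 - \<alpha>) + 2 * r powr (1 - \<alpha>) \<le> 3 / (1 - \<alpha>) * r powr (1 - \<alpha>)" by simp
  qed
  finally show ?thesis .
qed

lemma prod_mono_ennreal:
  fixes f g :: "'b \<Rightarrow> ennreal"
  assumes "\<And>i. i \<in> A \<Longrightarrow> f i \<le> g i"
  shows "prod f A \<le> prod g A"
  using assms by (induct A rule: infinite_finite_induct) (auto intro: mult_mono)

text \<open>
  With \<open>A\<close> a ball this is the growth condition; with \<open>A = wall_region e\<close> it shows that the total mass is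
  finite.
\<close>

lemma nn_integral_wall_weight_box:
  fixes a e :: "'a::euclidean_space"
  assumes \<alpha>: "0 < \<alpha>" "\<alpha> < 1" and r: "0 < r" and e: "e \<in> Basis"
    and A: "\<And>x. x \<in> A \<Longrightarrow> \<forall>b\<in>Basis. \<bar>x \<bullet> b - a \<bullet> b\<bar> < r"
  shows "(\<integral>\<^sup>+ x. ennreal (wall_weight \<alpha> e x) * indicator A x \<partial>lborel)
    \<le> ennreal (3 / (1 - \<alpha>) * 2 ^ (DIM('a) - 1) * r powr (real DIM('a) - \<alpha>))"
proof -
  define g where "g b t = ennreal (wall_factor \<alpha> e b t) * indicator {a \<bullet> b - r<..<a \<bullet> b + r} t" for b t
  have [measurable]: "g b \<in> borel_measurable borel" for b unfolding g_def[abs_def] by measurable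
  have "(\<integral>\<^sup>+ x. ennreal (wall_weight \<alpha> e x) * indicator A x \<partial>lborel) \<le> (\<integral>\<^sup>+ (x::'a). (\<Prod>b\<in>Basis. g b (x \<bullet> b)) \<partial>lborel)"
  proof (rule nn_integral_mono)
    fix x :: 'a
    show "ennreal (wall_weight \<alpha> e x) * indicator A x \<le> (\<Prod>b\<in>Basis. g b (x \<bullet> b))"
    proof (cases "x \<in> A")
      case True
      have "x \<bullet> b \<in> {a \<bullet> b - r<..<a \<bullet> b + r}" if "b \<in> Basis" for b
        using A[OF True] that by (auto simp: abs_less_iff)
      then have "(\<Prod>b\<in>Basis. g b (x \<bullet> b)) = (\<Prod>b\<in>Basis. ennreal (wall_factor \<alpha> e b (x \<bullet> b)))"
        by (intro prod.cong) (simp_all add: g_def)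
      then show ?thesis using True by (simp add: wall_weight_def prod_ennreal)
    qed simp
  qed
  also have "\<dots> = (\<Prod>b\<in>Basis. \<integral>\<^sup>+ t. g b t \<partial>lborel)"
    by (rule nn_integral_lborel_prod) auto
  also have "\<dots> = (\<integral>\<^sup>+ t. g e t \<partial>lborel) * (\<Prod>b\<in>Basis - {e}. \<integral>\<^sup>+ t. g b t \<partial>lborel)"
    using e by (intro prod.remove) auto
  also have "\<dots> \<le> ennreal (3 / (1 - \<alpha>) * r powr (1 - \<alpha>)) * (\<Prod>b\<in>Basis - {e}. ennreal (2 * r))"
  proof (rule mult_mono)
    show "(\<integral>\<^sup>+ t. g e t \<partial>lborel) \<le> ennreal (3 / (1 - \<alpha>) * r powr (1 - \<alpha>))"
      unfolding g_def by (rule nn_integral_wall_factor[OF \<alpha> r])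
    show "(\<Prod>b\<in>Basis - {e}. \<integral>\<^sup>+ t. g b t \<partial>lborel) \<le> (\<Prod>b\<in>Basis - {e}. ennreal (2 * r))"
    proof (rule prod_mono_ennreal)
      fix b assume "b \<in> Basis - {e}"
      then have "(\<integral>\<^sup>+ t. g b t \<partial>lborel) \<le> (\<integral>\<^sup>+ t. indicator {a \<bullet> b - r<..<a \<bullet> b + r} t \<partial>lborel)"
        by (intro nn_integral_mono) (auto simp: g_def wall_factor_def indicator_def)
      then show "(\<integral>\<^sup>+ t. g b t \<partial>lborel) \<le> ennreal (2 * r)" using r by simp
    qed
  qed auto
  also have "\<dots> = ennreal (3 / (1 - \<alpha>) * r powr (1 - \<alpha>) * (2 * r) ^ (DIM('a) - 1))"
  proof -
    have "(\<Prod>b\<in>Basis - {e}. ennreal (2 * r)) = ennreal ((2 * r) ^ (DIM('a) - 1))"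
      using e r by (subst prod_ennreal) (auto simp: card_Diff_singleton)
    moreover have "0 \<le> (2 * r) ^ (DIM('a) - 1)" using r by simp
    ultimately show ?thesis by (simp only: ennreal_mult'')
  qed
  also have "r powr (1 - \<alpha>) * r ^ (DIM('a) - 1) = r powr (real DIM('a) - \<alpha>)"
  proof -
    have "r ^ (DIM('a) - 1) = r powr (real DIM('a) - 1)"
      using r DIM_positive[where 'a = 'a] by (simp add: powr_realpow[symmetric] of_nat_diff Suc_le_eq)
    then show ?thesis by (simp add: powr_add[symmetric])
  qed
  then have "3 / (1 - \<alpha>) * r powr (1 - \<alpha>) * (2 * r) ^ (DIM('a) - 1)
      = 3 / (1 - \<alpha>) * 2 ^ (DIM('a) - 1) * r powr (real DIM('a) - \<alpha>)"
    by (simp add: power_mult_distrib mult_ac)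
  finally show ?thesis .
qed

lemma nn_integral_reciprocal_unit: "(\<integral>\<^sup>+ t. ennreal (1 / (t - 1)) * indicator {1<..<2} t \<partial>lborel) = \<infinity>"
proof -
  have "ennreal (real N) \<le> (\<integral>\<^sup>+ t. ennreal (1 / (t - 1)) * indicator {1<..<2} t \<partial>lborel)" for N
  proof -
    define a where "a = 1 + exp (- real N - 1)"
    define b :: real where "b = 1 + exp (- 1)"
    have ab: "1 < a" "a \<le> b" "b < 2" by (auto simp: a_def b_def)
    have "ennreal (real N) = ennreal (ln (b - 1) - ln (a - 1))" by (simp add: a_def b_def)
    also have "\<dots> = (\<integral>\<^sup>+ t. ennreal (1 / (t - 1)) * indicator {a..b} t \<partial>lborel)"
      using ab by (intro nn_integral_FTC_Icc[symmetric]) (auto intro!: derivative_eq_intros)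
    also have "\<dots> \<le> (\<integral>\<^sup>+ t. ennreal (1 / (t - 1)) * indicator {1<..<2} t \<partial>lborel)"
      using ab by (intro nn_integral_mono) (auto simp: indicator_def)
    finally show ?thesis .
  qed
  then have "(\<integral>\<^sup>+ t. ennreal (1 / (t - 1)) * indicator {1<..<2} t \<partial>lborel) \<ge> (SUP N. of_nat N)"
    by (intro SUP_least) (simp add: ennreal_of_nat_eq_real_of_nat)
  then show ?thesis by (simp add: ennreal_SUP_of_nat_eq_top top_unique)
qed

definition wall_measure :: "real \<Rightarrow> real \<Rightarrow> 'a \<Rightarrow> 'a::euclidean_space measure" where
  "wall_measure c \<alpha> e = density lborel (\<lambda>x. ennreal (c * wall_weight \<alpha> e x))"

text \<open>
  A ball is contained in the cube with the same centre whose half side length is the radius, and over a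
  cube the integral of the density is a product.
\<close>

lemma ball_growth_wall_measure:
  fixes e :: "'a::euclidean_space"
  assumes \<alpha>: "0 < \<alpha>" "\<alpha> < 1" and c: "0 \<le> c" and e: "e \<in> Basis"
  shows "ball_growth (c * (3 / (1 - \<alpha>) * 2 ^ (DIM('a) - 1))) (real DIM('a) - \<alpha>) (wall_measure c \<alpha> e)"
  unfolding ball_growth_def
proof (intro allI impI)
  fix x :: 'a and r :: real assume r: "0 < r"
  have [measurable]: "ball x r \<in> sets borel" by simp
  have "emeasure (wall_measure c \<alpha> e) (ball x r)
      = (\<integral>\<^sup>+ y. ennreal c * (ennreal (wall_weight \<alpha> e y) * indicator (ball x r) y) \<partial>lborel)"
    using c by (simp add: wall_measure_def emeasure_density ennreal_mult mult.assoc)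
  also have "\<dots> = ennreal c * (\<integral>\<^sup>+ y. ennreal (wall_weight \<alpha> e y) * indicator (ball x r) y \<partial>lborel)"
    by (intro nn_integral_cmult) measurable
  also have "\<dots> \<le> ennreal c * ennreal (3 / (1 - \<alpha>) * 2 ^ (DIM('a) - 1) * r powr (real DIM('a) - \<alpha>))"
  proof (intro mult_left_mono nn_integral_wall_weight_box[where a = x] \<alpha> r e ballI)
    fix y b :: 'a assume y: "y \<in> ball x r" and b: "b \<in> Basis"
    have "\<bar>(y - x) \<bullet> b\<bar> \<le> norm (y - x)" using b by (rule Basis_le_norm)
    also have "\<dots> < r" using y by (simp add: dist_norm norm_minus_commute)
    finally show "\<bar>y \<bullet> b - x \<bullet> b\<bar> < r" by (simp add: inner_diff_left)
  qed simp
  also have "\<dots> = ennreal (c * (3 / (1 - \<alpha>) * 2 ^ (DIM('a) - 1)) * r powr (real DIM('a) - \<alpha>))"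
    using c by (simp add: ennreal_mult'[symmetric] mult.assoc)
  finally show "emeasure (wall_measure c \<alpha> e) (ball x r)
      \<le> ennreal (c * (3 / (1 - \<alpha>) * 2 ^ (DIM('a) - 1)) * r powr (real DIM('a) - \<alpha>))" .
qed

lemma radon_measure_finite_borel:
  fixes \<mu> :: "'a::euclidean_space measure"
  assumes sets: "sets \<mu> = sets borel" and fin: "emeasure \<mu> UNIV < \<infinity>"
  shows "radon_measure \<mu>"
proof -
  have space: "space \<mu> = UNIV" using sets_eq_imp_space_eq[OF sets] by simp
  have fin': "emeasure \<mu> (space \<mu>) \<noteq> \<infinity>" using fin by (simp add: space)
  show ?thesis unfolding radon_measure_def
  proof (intro conjI allI ballI impI)
    fix K :: "'a set"
    show "emeasure \<mu> K < \<infinity>"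
      using emeasure_mono[of K UNIV \<mu>] fin sets by (auto intro: le_less_trans)
  next
    fix A :: "'a set" assume "A \<in> sets borel"
    from outer_regular[OF sets fin' this]
    show "emeasure \<mu> A = (INF U\<in>{U. open U \<and> A \<subseteq> U}. emeasure \<mu> U)" by (simp add: conj_commute)
  next
    fix U :: "'a set" assume "open U"
    then have "U \<in> sets borel" by simp
    from inner_regular[OF sets fin' this]
    show "emeasure \<mu> U = (SUP K\<in>{K. compact K \<and> K \<subseteq> U}. emeasure \<mu> K)" by (simp add: conj_commute)
  qed (rule sets)
qed

lemma radon_measure_wall_measure:
  fixes e :: "'a::euclidean_space"
  assumes \<alpha>: "0 < \<alpha>" "\<alpha> < 1" and c: "0 \<le> c" and e: "e \<in> Basis"
  shows "radon_measure (wall_measure c \<alpha> e)"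
proof (rule radon_measure_finite_borel)
  show "sets (wall_measure c \<alpha> e) = sets borel" by (simp add: wall_measure_def)
  have "emeasure (wall_measure c \<alpha> e) UNIV
      = (\<integral>\<^sup>+ x. ennreal c * (ennreal (wall_weight \<alpha> e x) * indicator (wall_region e) x) \<partial>lborel)"
  proof -
    have "ennreal (c * wall_weight \<alpha> e x) = ennreal c * (ennreal (wall_weight \<alpha> e x) * indicator (wall_region e) x)" for x
      using c wall_weight_support[OF e, of \<alpha> x] by (cases "wall_weight \<alpha> e x = 0") (simp_all add: ennreal_mult)
    moreover have "emeasure (wall_measure c \<alpha> e) UNIV = (\<integral>\<^sup>+ x. ennreal (c * wall_weight \<alpha> e x) \<partial>lborel)"
      by (simp add: wall_measure_def emeasure_density)
    ultimately show ?thesis by (simp only:)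
  qed
  also have "\<dots> = ennreal c * (\<integral>\<^sup>+ x. ennreal (wall_weight \<alpha> e x) * indicator (wall_region e) x \<partial>lborel)"
  proof (rule nn_integral_cmult)
    have "wall_region e = {x. 1 < x \<bullet> e} \<inter> {x. x \<bullet> e < 2} \<inter> (\<Inter>b\<in>Basis - {e}. {x. 0 < x \<bullet> b} \<inter> {x. x \<bullet> b < 1})"
      by (auto simp: wall_region_def)
    then have "open (wall_region e)"
      by (auto intro!: open_Int open_INT open_Collect_less continuous_intros)
    then have [measurable]: "wall_region e \<in> sets borel" by simp
    show "(\<lambda>x. ennreal (wall_weight \<alpha> e x) * indicator (wall_region e) x) \<in> borel_measurable lborel"
      by measurable
  qed
  also have "\<dots> \<le> ennreal c * ennreal (3 / (1 - \<alpha>) * 2 ^ (DIM('a) - 1) * 1 powr (real DIM('a) - \<alpha>))"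
  proof (intro mult_left_mono nn_integral_wall_weight_box[where a = "\<Sum>Basis"] \<alpha> e ballI)
    fix x b :: 'a assume x: "x \<in> wall_region e" and b: "b \<in> Basis"
    show "\<bar>x \<bullet> b - \<Sum>Basis \<bullet> b\<bar> < 1"
    proof (cases "b = e")
      case False
      then have "0 < x \<bullet> b" "x \<bullet> b < 1" using x b by (auto simp: wall_region_def)
      then show ?thesis using b by (simp add: abs_less_iff)
    qed (use x b in \<open>simp add: wall_region_def abs_less_iff\<close>)
  qed simp_all
  also have "\<dots> < \<infinity>" by (simp add: ennreal_mult_less_top)
  finally show "emeasure (wall_measure c \<alpha> e) UNIV < \<infinity>" .
qed

text \<open>
  The exponents \<open>- \<alpha>\<close> of the density and \<open>\<alpha> - 1\<close> of the blow-up add up to \<open>-1\<close>, the first exponent that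
  is not integrable at the face.
\<close>

lemma nn_integral_wall_measure_critical:
  fixes e :: "'a::euclidean_space"
  assumes c: "0 < c" and k: "0 < k" and e: "e \<in> Basis"
  shows "(\<integral>\<^sup>+ x. ennreal (c * wall_weight \<alpha> e x) * ennreal (k * (x \<bullet> e - 1) powr (\<alpha> - 1)) \<partial>lborel)
    = \<infinity>"
proof -
  define g where "g b t = (if b = e then ennreal (1 / (t - 1)) * indicator {1<..<2} t
     else indicator {0<..<1} t)" for b t
  have [measurable]: "g b \<in> borel_measurable borel" for b unfolding g_def[abs_def] by measurable
  have "(\<integral>\<^sup>+ x. ennreal (c * wall_weight \<alpha> e x) * ennreal (k * (x \<bullet> e - 1) powr (\<alpha> - 1)) \<partial>lborel)
      = (\<integral>\<^sup>+ (x::'a). ennreal (c * k) * (\<Prod>b\<in>Basis. g b (x \<bullet> b)) \<partial>lborel)"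
  proof (rule nn_integral_cong)
    fix x :: 'a
    have "wall_weight \<alpha> e x * (x \<bullet> e - 1) powr (\<alpha> - 1)
        = (1 / (x \<bullet> e - 1) * indicator {1<..<2} (x \<bullet> e)) * (\<Prod>b\<in>Basis - {e}. indicator {0<..<1} (x \<bullet> b))"
    proof -
      have "wall_weight \<alpha> e x = wall_factor \<alpha> e e (x \<bullet> e) * (\<Prod>b\<in>Basis - {e}. wall_factor \<alpha> e b (x \<bullet> b))"
        unfolding wall_weight_def using e by (intro prod.remove) auto
      also have "(\<Prod>b\<in>Basis - {e}. wall_factor \<alpha> e b (x \<bullet> b)) = (\<Prod>b\<in>Basis - {e}. indicator {0<..<1} (x \<bullet> b))"
        by (intro prod.cong) (auto simp: wall_factor_def)
      finally have w: "wall_weight \<alpha> e x = wall_factor \<alpha> e e (x \<bullet> e) * (\<Prod>b\<in>Basis - {e}. indicator {0<..<1} (x \<bullet> b))" .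
      have "wall_factor \<alpha> e e t * (t - 1) powr (\<alpha> - 1) = 1 / (t - 1) * indicator {1<..<2} t" for t
      proof (cases "t \<in> {1<..<2}")
        case True
        then have "(t - 1) powr - \<alpha> * (t - 1) powr (\<alpha> - 1) = (t - 1) powr - 1"
          by (simp add: powr_add[symmetric])
        then show ?thesis using True by (simp add: wall_factor_def powr_minus_divide)
      qed (simp add: wall_factor_def)
      from this[of "x \<bullet> e"] show ?thesis unfolding w
        by (subst mult.commute[of "wall_factor \<alpha> e e (x \<bullet> e)"], subst mult.assoc) (simp add: mult.commute)
    qed
    moreover have "ennreal ((1 / (x \<bullet> e - 1) * indicator {1<..<2} (x \<bullet> e)) * (\<Prod>b\<in>Basis - {e}. indicator {0<..<1} (x \<bullet> b)))
        = (\<Prod>b\<in>Basis. g b (x \<bullet> b))"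
    proof -
      have "(\<Prod>b\<in>Basis. g b (x \<bullet> b)) = g e (x \<bullet> e) * (\<Prod>b\<in>Basis - {e}. g b (x \<bullet> b))"
        using e by (intro prod.remove) auto
      also have "(\<Prod>b\<in>Basis - {e}. g b (x \<bullet> b)) = (\<Prod>b\<in>Basis - {e}. ennreal (indicator {0<..<1} (x \<bullet> b)))"
        by (intro prod.cong) (auto simp: g_def ennreal_indicator)
      also have "\<dots> = ennreal (\<Prod>b\<in>Basis - {e}. indicator {0<..<1} (x \<bullet> b))"
        by (intro prod_ennreal) simp
      also have "g e (x \<bullet> e) = ennreal (1 / (x \<bullet> e - 1) * indicator {1<..<2} (x \<bullet> e))"
        by (cases "x \<bullet> e \<in> {1<..<2}") (simp_all add: g_def)
      finally have "(\<Prod>b\<in>Basis. g b (x \<bullet> b)) = ennreal (1 / (x \<bullet> e - 1) * indicator {1<..<2} (x \<bullet> e))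
          * ennreal (\<Prod>b\<in>Basis - {e}. indicator {0<..<1} (x \<bullet> b))" .
      moreover have "0 \<le> (\<Prod>b\<in>Basis - {e}. indicator {0<..<1} (x \<bullet> b) :: real)" by (simp add: prod_nonneg)
      ultimately show ?thesis by (simp only: ennreal_mult'')
    qed
    ultimately have "ennreal (wall_weight \<alpha> e x * (x \<bullet> e - 1) powr (\<alpha> - 1)) = (\<Prod>b\<in>Basis. g b (x \<bullet> b))"
      by simp
    moreover have "(c * wall_weight \<alpha> e x) * (k * (x \<bullet> e - 1) powr (\<alpha> - 1))
        = (c * k) * (wall_weight \<alpha> e x * (x \<bullet> e - 1) powr (\<alpha> - 1))"
      by (simp only: mult_ac)
    then have "ennreal (c * wall_weight \<alpha> e x) * ennreal (k * (x \<bullet> e - 1) powr (\<alpha> - 1))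
        = ennreal (c * k) * ennreal (wall_weight \<alpha> e x * (x \<bullet> e - 1) powr (\<alpha> - 1))"
      using c k by (simp only: ennreal_mult'[symmetric] mult_nonneg_nonneg less_imp_le wall_weight_nonneg)
    ultimately show "ennreal (c * wall_weight \<alpha> e x) * ennreal (k * (x \<bullet> e - 1) powr (\<alpha> - 1))
        = ennreal (c * k) * (\<Prod>b\<in>Basis. g b (x \<bullet> b))"
      by simp
  qed
  also have "\<dots> = ennreal (c * k) * (\<integral>\<^sup>+ (x::'a). (\<Prod>b\<in>Basis. g b (x \<bullet> b)) \<partial>lborel)"
    by (intro nn_integral_cmult) measurable
  also have "(\<integral>\<^sup>+ (x::'a). (\<Prod>b\<in>Basis. g b (x \<bullet> b)) \<partial>lborel) = (\<Prod>b\<in>Basis. \<integral>\<^sup>+ t. g b t \<partial>lborel)"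
    by (rule nn_integral_lborel_prod) auto
  also have "\<dots> = (\<integral>\<^sup>+ t. g e t \<partial>lborel) * (\<Prod>b\<in>Basis - {e}. \<integral>\<^sup>+ t. g b t \<partial>lborel)"
    using e by (intro prod.remove) auto
  also have "(\<Prod>b\<in>Basis - {e}. \<integral>\<^sup>+ t. g b t \<partial>lborel) = 1"
    by (intro prod.neutral) (auto simp: g_def)
  also have "(\<integral>\<^sup>+ t. g e t \<partial>lborel) = \<infinity>"
    using nn_integral_reciprocal_unit by (simp add: g_def)
  finally show ?thesis using c k by (simp add: ennreal_mult_top)
qed

section \<open>Failure of the trace inequality\<close>

theorem theorem1p3:
  fixes \<alpha> C' :: real
  assumes "0 < \<alpha>" and "\<alpha> < 1" and "0 < C'"
  shows "\<not> (\<exists>C>0. \<forall>(u :: 'a::euclidean_space \<Rightarrow> real) (Du :: 'a \<Rightarrow> 'a) (\<mu> :: 'a measure).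
            (\<exists>q. 1 \<le> q \<and> q < real DIM('a) / (1 - \<alpha>) \<and> in_Lp q u) \<longrightarrow>
            continuous_on UNIV u \<longrightarrow>
            frac_gradient_L1 \<alpha> u Du \<longrightarrow>
            radon_measure \<mu> \<longrightarrow>
            ball_growth C' (real DIM('a) - \<alpha>) \<mu> \<longrightarrow>
            (\<integral>\<^sup>+ x. ennreal \<bar>u x\<bar> \<partial>\<mu>) \<le> ennreal (C * (LINT x|lborel. norm (Du x))))"
proof (rule notI, elim exE conjE)
  fix C :: real
  assume "0 < C" and bound [rule_format]: "\<forall>(u :: 'a \<Rightarrow> real) (Du :: 'a \<Rightarrow> 'a) (\<mu> :: 'a measure).
            (\<exists>q. 1 \<le> q \<and> q < real DIM('a) / (1 - \<alpha>) \<and> in_Lp q u) \<longrightarrow>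
            continuous_on UNIV u \<longrightarrow>
            frac_gradient_L1 \<alpha> u Du \<longrightarrow>
            radon_measure \<mu> \<longrightarrow>
            ball_growth C' (real DIM('a) - \<alpha>) \<mu> \<longrightarrow>
            (\<integral>\<^sup>+ x. ennreal \<bar>u x\<bar> \<partial>\<mu>) \<le> ennreal (C * (LINT x|lborel. norm (Du x)))"
  \<comment> \<open>the Riesz potential of order \<open>1 - \<alpha> = 2 * \<beta>\<close> inverts \<open>(-\<Delta>)\<^sup>\<beta>\<close>\<close>
  define \<beta> where "\<beta> = (1 - \<alpha>) / 2"
  have \<beta>: "0 < \<beta>" "\<beta> < 1 / 2" "\<beta> < 1" and \<alpha>_eq: "1 - 2 * \<beta> = \<alpha>" "- 2 * \<beta> = \<alpha> - 1"
    using assms by (simp_all add: \<beta>_def field_simps)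
  obtain e :: 'a where e: "e \<in> Basis" using nonempty_Basis by blast
  \<comment> \<open>normalises the measure to the prescribed growth constant\<close>
  define m where "m = C' / (3 / (1 - \<alpha>) * 2 ^ (DIM('a) - 1))"
  have m: "0 < m" "m * (3 / (1 - \<alpha>) * 2 ^ (DIM('a) - 1)) = C'"
    using assms by (simp_all add: m_def)
  define \<mu> where "\<mu> = wall_measure m \<alpha> e"
  have \<mu>: "radon_measure \<mu>" "ball_growth C' (real DIM('a) - \<alpha>) \<mu>"
    using radon_measure_wall_measure[OF assms(1,2) _ e, of m]
      ball_growth_wall_measure[OF assms(1,2) _ e, of m] m by (simp_all add: \<mu>_def)
  obtain V where V: "\<And>\<epsilon>. 0 < \<epsilon> \<Longrightarrow> \<exists>g. frac_gradient_L1 \<alpha> (mollified_frac_laplacian \<beta> \<epsilon>) g \<and>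
      (LINT x|lborel. norm (g (x :: 'a))) \<le> V"
    using mollified_frac_laplacian_frac_gradient[OF \<beta>(1,2), where 'a = 'a] unfolding \<alpha>_eq by blast
  define u :: "nat \<Rightarrow> 'a \<Rightarrow> real" where "u n = mollified_frac_laplacian \<beta> (1 / real (Suc n))" for n
  have u_bound: "(\<integral>\<^sup>+ x. ennreal \<bar>u n x\<bar> \<partial>\<mu>) \<le> ennreal (C * V)" for n
  proof -
    have pos: "0 < 1 / real (Suc n)" by simp
    obtain g where g: "frac_gradient_L1 \<alpha> (u n) g" "(LINT x|lborel. norm (g x)) \<le> V"
      using V[OF pos] unfolding u_def by blast
    \<comment> \<open>the exponent \<open>q = 1\<close> is admissible in every dimension\<close>
    have "in_Lp 1 (u n)"
      using integrable_mollified_frac_laplacian[OF \<beta>(1,3) pos, where 'a = 'a] by (simp add: in_Lp_def u_def)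
    moreover have "1 < real DIM('a) / (1 - \<alpha>)"
    proof -
      have "1 \<le> real DIM('a)" using DIM_positive[where 'a = 'a] by (simp add: Suc_le_eq)
      then have "1 - \<alpha> < real DIM('a)" using assms(1) by linarith
      then show ?thesis using assms by (simp add: less_divide_eq)
    qed
    ultimately have q: "\<exists>q. 1 \<le> q \<and> q < real DIM('a) / (1 - \<alpha>) \<and> in_Lp q (u n)" by force
    have "continuous_on UNIV (u n)"
      unfolding u_def by (rule continuous_mollified_frac_laplacian[OF \<beta>(1,3) pos])
    from bound[OF q this g(1) \<mu>]
    have "(\<integral>\<^sup>+ x. ennreal \<bar>u n x\<bar> \<partial>\<mu>) \<le> ennreal (C * (LINT x|lborel. norm (g x)))" .
    also have "\<dots> \<le> ennreal (C * V)" using g(2) \<open>0 < C\<close> by (intro ennreal_leI mult_left_mono) auto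
    finally show ?thesis .
  qed
  obtain k where k: "0 < k" "\<And>(e :: 'a) x. e \<in> Basis \<Longrightarrow> x \<in> wall_region e \<Longrightarrow>
      \<forall>\<^sub>F n in sequentially. k * (x \<bullet> e - 1) powr (- 2 * \<beta>) \<le> \<bar>mollified_frac_laplacian \<beta> (1 / real (Suc n)) x\<bar>"
    using mollified_frac_laplacian_blowup[OF \<beta>(1,2), where 'a = 'a] by blast
  have [measurable]: "u n \<in> borel_measurable borel" for n unfolding u_def by measurable
  \<comment> \<open>Fatou's lemma with the pointwise lower bound, whose integral is infinite\<close>
  have "\<infinity> = (\<integral>\<^sup>+ x. ennreal (m * wall_weight \<alpha> e x) * ennreal (k * (x \<bullet> e - 1) powr (\<alpha> - 1)) \<partial>lborel)"
    using nn_integral_wall_measure_critical[OF m(1) k(1) e, of \<alpha>] by simp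
  also have "\<dots> \<le> (\<integral>\<^sup>+ x. ennreal (m * wall_weight \<alpha> e x) * liminf (\<lambda>n. ennreal \<bar>u n x\<bar>) \<partial>lborel)"
  proof (rule nn_integral_mono)
    fix x
    show "ennreal (m * wall_weight \<alpha> e x) * ennreal (k * (x \<bullet> e - 1) powr (\<alpha> - 1))
        \<le> ennreal (m * wall_weight \<alpha> e x) * liminf (\<lambda>n. ennreal \<bar>u n x\<bar>)"
    proof (cases "wall_weight \<alpha> e x = 0")
      case False
      then have "\<forall>\<^sub>F n in sequentially. k * (x \<bullet> e - 1) powr (\<alpha> - 1) \<le> \<bar>u n x\<bar>"
        unfolding u_def \<alpha>_eq(2)[symmetric] by (intro k(2) e wall_weight_support)
      then have "ennreal (k * (x \<bullet> e - 1) powr (\<alpha> - 1)) \<le> liminf (\<lambda>n. ennreal \<bar>u n x\<bar>)"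
        by (intro Liminf_bounded) (auto elim!: eventually_mono intro: ennreal_leI)
      then show ?thesis by (rule mult_left_mono) simp
    qed simp
  qed
  also have "\<dots> = (\<integral>\<^sup>+ x. liminf (\<lambda>n. ennreal \<bar>u n x\<bar>) \<partial>\<mu>)"
    unfolding \<mu>_def wall_measure_def by (subst nn_integral_density) auto
  also have "\<dots> \<le> liminf (\<lambda>n. \<integral>\<^sup>+ x. ennreal \<bar>u n x\<bar> \<partial>\<mu>)"
    by (intro nn_integral_liminf) (simp add: \<mu>_def wall_measure_def)
  also have "\<dots> \<le> liminf (\<lambda>n::nat. ennreal (C * V))"
    by (intro Liminf_mono) (simp add: u_bound)
  also have "\<dots> < \<infinity>" by (simp add: Liminf_const)
  finally show False by simp
qed

end
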